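(* Let $p\ge 2$. For $B>0$ and $c\in\mathbb{R}$, or $B=0$ and $c>0$, there exist $x_{B,c}>0$ and a compacton $\Phi_{B,c}:\mathbb{R}\to[0,\infty)$ such that $\phi=\Phi_{B,c}$ solves $$-c\phi'+\big(\phi(\phi\phi')'+\phi^{p-1}\big)'=0$$ in the sense of distributions on $\mathbb{R}$, and such that $\Phi_{B,c}$ is even, is compactly supported on $(-x_{B,c},x_{B,c})$ (it vanishes outside this interval), is decreasing on $(0,x_{B,c})$, and $\phi=\Phi_{B,c}$ satisfies $$-\frac{c}{2}\phi^2+\frac12(\phi\phi')^2+\frac1p\phi^p=B\quad\text{on }(-x_{B,c},x_{B,c}).$$ These compactons can be combined to yield multi-compacton solutions of the same equation (with the same $c$), $$\sum_i \epsilon_i\,\Phi_{B_i,c}(x-x_i),$$ where $\epsilon_i=\pm1$, $x_i\in\mathbb{R}$, each pair $(B_i,c)$ satisfies either $B_i>0$ and $c\in\mathbb{R}$, or $B_i=0$ and $c>0$, and the functions $\Phi_{B_i,c}(x-x_i)$ have non-overlapping supports.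
   Context: The equation is the profile equation for traveling waves $u(t,x)=\phi(x-ct)$ of the degenerate KdV equation $\partial_t u+\partial_x(u\partial_x(u\partial_x u)+u^{p-1})=0$, with $u$ real-valued, which is the Hamiltonian flow of $H(u)=\frac12\int|u\partial_xu|^2\,dx-\frac1p\int|u|^p\,dx$ for the symplectic form $(f,g)\mapsto\int\partial_x^{-1}f\,g\,dx$. A compacton here is a compactly supported traveling wave profile; $\Phi_{B,c}$ is positive and smooth on $(-x_{B,c},x_{B,c})$ and extended by $0$ outside. For sign-changing $\phi$, $\phi^{p-1}$ means $|\phi|^{p-2}\phi$. In the distributional formulation, for $\phi=\Phi_{B,c}$, $(\phi\phi')'$ is a bounded function plus possible Dirac masses at $\pm x_{B,c}$; since $\phi$ vanishes at these points, the product $\phi(\phi\phi')'$ is a bounded function.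
   Formalization: For p=2 the pairs (B,c) are restricted to B>0 and c<1, since for p=2 with B=0, or with B>0 and c≥1, no compacton with the stated properties exists; the sum over i is read as a finite or locally finite sum. *)

theory Defs
  imports "HOL-Analysis.Analysis"
begin

section \<open>Distributions on the real line\<close>

definition supp :: "(real \<Rightarrow> real) \<Rightarrow> real set" where
  "supp f = closure {x. f x \<noteq> 0}"

text \<open>Intended for open \<open>S\<close> only, where the iterated \<^const>\<open>deriv\<close> is meaningful.\<close>

definition smooth_on :: "real set \<Rightarrow> (real \<Rightarrow> real) \<Rightarrow> bool" where
  "smooth_on S f \<longleftrightarrow> (\<forall>n. \<forall>x\<in>S. (deriv ^^ n) f differentiable (at x))"

definition test_function :: "(real \<Rightarrow> real) \<Rightarrow> bool" where
  "test_function \<psi> \<longleftrightarrow> smooth_on UNIV \<psi> \<and> compact (supp \<psi>)"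

text \<open>
  Distributions are represented by functionals on functions. Only their values on test
  functions matter, so they are compared with \<open>dist_eq\<close> and not with equality.
\<close>

type_synonym distribution = "(real \<Rightarrow> real) \<Rightarrow> real"

definition dist_eq :: "distribution \<Rightarrow> distribution \<Rightarrow> bool" where
  "dist_eq T U \<longleftrightarrow> (\<forall>\<psi>. test_function \<psi> \<longrightarrow> T \<psi> = U \<psi>)"

definition dist_deriv :: "distribution \<Rightarrow> distribution" where
  "dist_deriv T = (\<lambda>\<psi>. - T (deriv \<psi>))"

definition dist_fun :: "(real \<Rightarrow> real) \<Rightarrow> distribution" where
  "dist_fun f = (\<lambda>\<psi>. LINT x|lborel. f x * \<psi> x)"

text \<open>
  The measure with density \<open>g\<close> and a Dirac mass \<open>a y\<close> at each point \<open>y\<close> of \<open>S\<close>. It is used for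
  \<open>S\<close> meeting every compact set in a finite set, so that the sum below is finite.
\<close>

definition dist_meas ::
  "(real \<Rightarrow> real) \<Rightarrow> real set \<Rightarrow> (real \<Rightarrow> real) \<Rightarrow> distribution" where
  "dist_meas g S a = (\<lambda>\<psi>. dist_fun g \<psi> + (\<Sum>y\<in>S \<inter> supp \<psi>. a y * \<psi> y))"

definition locally_integrable :: "(real \<Rightarrow> real) \<Rightarrow> bool" where
  "locally_integrable f \<longleftrightarrow> (\<forall>K. compact K \<longrightarrow> set_integrable lborel K f)"

definition locally_bounded :: "(real \<Rightarrow> real) \<Rightarrow> bool" where
  "locally_bounded f \<longleftrightarrow> (\<forall>K. compact K \<longrightarrow> bounded (f ` K))"


section \<open>The profile equation\<close>

text \<open>
  \<open>\<phi>\<close> is a solution of \<open>- c \<phi>' + (\<phi> (\<phi> \<phi>')' + \<phi>\<^sup>p\<^sup>-\<^sup>1)' = 0\<close> in the sense of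
  distributions, where \<open>\<phi>\<^sup>p\<^sup>-\<^sup>1\<close> stands for \<open>|\<phi>|\<^sup>p\<^sup>-\<^sup>2 \<phi>\<close>. The products are given a meaning as follows.
  The function \<open>\<phi>\<close> is continuous with a locally integrable distributional derivative \<open>v\<close>, so
  \<open>\<phi> \<phi>' = \<phi> v\<close> is locally integrable. Its distributional derivative \<open>(\<phi> \<phi>')'\<close> is a locally bounded
  function \<open>g\<close> plus Dirac masses \<open>a y\<close> at a locally finite set of points \<open>y\<close>. Multiplying this
  measure by the continuous function \<open>\<phi>\<close> gives \<open>\<phi> g\<close> plus the masses \<open>\<phi> y * a y\<close>, which vanish
  where \<open>\<phi>\<close> does. Up to null sets and points with \<open>a y = 0\<close>, the data \<open>v\<close>, \<open>g\<close>, \<open>S\<close>, \<open>a\<close>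
  are determined by \<open>\<phi>\<close>.
\<close>

definition solves_profile_eq :: "real \<Rightarrow> real \<Rightarrow> (real \<Rightarrow> real) \<Rightarrow> bool" where
  "solves_profile_eq p c \<phi> \<longleftrightarrow>
     continuous_on UNIV \<phi> \<and>
     (\<exists>v g S a.
        locally_integrable v \<and>
        dist_eq (dist_deriv (dist_fun \<phi>)) (dist_fun v) \<and>
        g \<in> borel_measurable borel \<and> locally_bounded g \<and>
        (\<forall>K. compact K \<longrightarrow> finite (S \<inter> K)) \<and>
        dist_eq (dist_deriv (dist_fun (\<lambda>x. \<phi> x * v x))) (dist_meas g S a) \<and>
        dist_eq
          (\<lambda>\<psi>. - c * dist_deriv (dist_fun \<phi>) \<psi>
             + dist_deriv (\<lambda>\<eta>. dist_meas (\<lambda>x. \<phi> x * g x) S (\<lambda>y. \<phi> y * a y) \<eta>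
                               + dist_fun (\<lambda>x. \<bar>\<phi> x\<bar> powr (p - 2) * \<phi> x) \<eta>) \<psi>)
          (\<lambda>\<psi>. 0))"


section \<open>Compactons\<close>

definition is_compacton ::
  "real \<Rightarrow> real \<Rightarrow> real \<Rightarrow> real \<Rightarrow> (real \<Rightarrow> real) \<Rightarrow> bool" where
  "is_compacton p B c X \<phi> \<longleftrightarrow>
     X > 0 \<and>
     (\<forall>x. 0 \<le> \<phi> x) \<and>
     (\<forall>x\<in>{-X<..<X}. 0 < \<phi> x) \<and>
     smooth_on {-X<..<X} \<phi> \<and>
     (\<forall>x. x \<notin> {-X<..<X} \<longrightarrow> \<phi> x = 0) \<and>
     (\<forall>x. \<phi> (- x) = \<phi> x) \<and>
     strict_antimono_on {0<..<X} \<phi> \<and>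
     solves_profile_eq p c \<phi> \<and>
     (\<forall>x\<in>{-X<..<X}.
        - (c / 2) * (\<phi> x)\<^sup>2 + 1 / 2 * (\<phi> x * deriv \<phi> x)\<^sup>2 + 1 / p * \<phi> x powr p = B)"

text \<open>
  At the endpoint \<open>p = 2\<close> the first-order equation reads \<open>(\<phi> \<phi>')\<^sup>2 = 2 B + (c - 1) \<phi>\<^sup>2\<close>, and at
  the maximum of \<open>\<phi>\<close> this forces \<open>B > 0\<close> and \<open>c < 1\<close>; see \<open>no_compacton_p_2\<close> below. Hence
  the extra condition for \<open>p = 2\<close>.
\<close>

definition admissible :: "real \<Rightarrow> real \<Rightarrow> real \<Rightarrow> bool" where
  "admissible p B c \<longleftrightarrow> (0 < B \<or> B = 0 \<and> 0 < c) \<and> (p = 2 \<longrightarrow> 0 < B \<and> c < 1)"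

lemma no_compacton_p_2:
  assumes B: "0 < B \<or> B = 0 \<and> 0 < c" and bad: "\<not> (0 < B \<and> c < 1)"
  shows "\<not> is_compacton 2 B c X \<phi>"
proof
  assume comp: "is_compacton 2 B c X \<phi>"
  have X: "X > 0" and even: "\<And>x. \<phi> (- x) = \<phi> x"
    and pos: "\<And>x. x \<in> {-X<..<X} \<Longrightarrow> 0 < \<phi> x"
    and decr: "strict_antimono_on {0<..<X} \<phi>"
    using comp by (auto simp: is_compacton_def)
  have diff: "\<phi> differentiable (at x)" if "x \<in> {-X<..<X}" for x
  proof -
    have "smooth_on {-X<..<X} \<phi>"
      using comp by (simp add: is_compacton_def)
    then have "(deriv ^^ 0) \<phi> differentiable (at x)"
      using that unfolding smooth_on_def by blast
    then show ?thesis by simp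
  qed
  have deriv: "(\<phi> has_real_derivative deriv \<phi> x) (at x)" if "x \<in> {-X<..<X}" for x
    using diff[OF that] by (auto simp: real_differentiable_def dest: DERIV_imp_deriv)
  have ode: "(1 - c) * (\<phi> x)\<^sup>2 + (\<phi> x * deriv \<phi> x)\<^sup>2 = 2 * B" if "x \<in> {-X<..<X}" for x
  proof -
    have "- (c / 2) * (\<phi> x)\<^sup>2 + 1 / 2 * (\<phi> x * deriv \<phi> x)\<^sup>2 + 1 / 2 * \<phi> x powr 2 = B"
      using comp that unfolding is_compacton_def by blast
    moreover have "\<phi> x powr 2 = (\<phi> x)\<^sup>2"
      using pos[OF that] by simp
    ultimately show ?thesis by (simp add: algebra_simps)
  qed
  have 0: "(0::real) \<in> {-X<..<X}" using X by simp
  have "(\<phi> has_real_derivative - deriv \<phi> 0) (at 0)"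
    using DERIV_mirror[of \<phi> "deriv \<phi> 0" 0] deriv[OF 0] by (simp only: even minus_zero)
  then have "deriv \<phi> 0 = 0"
    using DERIV_unique[of \<phi> "- deriv \<phi> 0" 0 "deriv \<phi> 0"] deriv[OF 0] by linarith
  then have top: "(1 - c) * (\<phi> 0)\<^sup>2 = 2 * B"
    using ode[OF 0] by simp
  have "\<not> 0 < B"
  proof
    assume "0 < B"
    moreover from this bad have "(1 - c) * (\<phi> 0)\<^sup>2 \<le> 0"
      by (simp add: mult_nonpos_nonneg)
    ultimately show False using top by simp
  qed
  with B have "B = 0" by auto
  with top pos[OF 0] have c: "c = 1" by simp
  have "deriv \<phi> x = 0" if "x \<in> {-X<..<X}" for x
    using ode[OF that] pos[OF that] c \<open>B = 0\<close> by simp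
  then have "(\<phi> has_real_derivative 0) (at x)" if "X/3 \<le> x" "x \<le> X/2" for x
    using deriv[of x] that X by simp
  then have "\<exists>z. X/3 < z \<and> z < X/2 \<and> \<phi> (X/2) - \<phi> (X/3) = (X/2 - X/3) * 0"
    using X by (intro MVT2) auto
  then have "\<phi> (X/3) = \<phi> (X/2)" by auto
  moreover have "\<phi> (X/2) < \<phi> (X/3)"
    using decr X unfolding monotone_on_def by simp
  ultimately show False by simp
qed


section \<open>Multi-compactons\<close>

text \<open>Supports that touch at an end point do not overlap.\<close>

definition non_overlapping :: "nat set \<Rightarrow> (nat \<Rightarrow> real \<Rightarrow> real) \<Rightarrow> bool" where
  "non_overlapping I f \<longleftrightarrow> disjoint_family_on (\<lambda>i. interior (supp (f i))) I"

text \<open>Every family indexed by a finite set is locally finite.\<close>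

definition locally_finite_family :: "nat set \<Rightarrow> (nat \<Rightarrow> real \<Rightarrow> real) \<Rightarrow> bool" where
  "locally_finite_family I f \<longleftrightarrow>
     (\<forall>K. compact K \<longrightarrow> finite {i \<in> I. supp (f i) \<inter> K \<noteq> {}})"

end

theory Submission
  imports Defs
begin

text \<open>
  For \<open>w = \<phi>\<^sup>2\<close> the first-order equation becomes \<open>(w')\<^sup>2 = G(w)\<close> with
  \<open>G(w) = 8 B + 4 c w - (8 / p) w\<^bsup>p/2\<^esup>\<close>. Concavity of \<open>G\<close> gives its first positive zero \<open>M\<close> and a bound
  \<open>G(w) \<ge> C w (M - w)\<close>. Writing \<open>w = M - y\<^sup>2\<close> removes the turning point: \<open>y' = \<surd>h(y) / 2\<close> with
  \<open>h(y) = G(M - y\<^sup>2) / y\<^sup>2\<close> positive and continuous, and the bound makes the quadrature converge, so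
  \<open>w\<close> reaches \<open>0\<close> at a finite \<open>X\<close>. Moreover \<open>w'' = G'(w) / 2\<close>, that is
  \<open>(\<phi> \<phi>')' = c - \<phi>\<^sup>p\<^sup>-\<^sup>2\<close> on \<open>(-X, X)\<close>, and integration by parts adds Dirac masses at \<open>\<plusminus>X\<close>, where \<open>\<phi>\<close>
  vanishes. All terms of the weak formulation are local, and at each point at most one bump of a
  multi-compacton is nonzero.
\<close>

section \<open>The potential well\<close>

text \<open>The end points are what force the passage from \<phi> to \<open>w\<close>: for
  \<open>B > 0\<close> the slope \<phi>' is unbounded there, while \<phi> \<phi>' = w' / 2 has a
  finite limit, whose size becomes the Dirac mass. Inserting (\<phi> \<phi>')^2 = (w')^2 / 4 into
  the first-order equation and multiplying by 8 produces the coefficients 8 B, 4 c and 8 / p. The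
  equation for \<open>w\<close> alone says nothing at the maximum, since the constant
  \<open>M\<close> solves it too; the coordinate \<open>y\<close> passes through the maximum with
  positive speed and so selects the moving solution. The lower bound on \<open>G\<close> carries a
  factor \<open>w\<close> because \<open>G(0) = 8 B\<close> may be zero. Time is the integral of 1 /
  sqrt(G), so simple zeros at both ends cost only inverse square root singularities, which are
  integrable. Signs are harmless in a superposition: a factor -1 drops out of \<phi> \<phi>' and of
  |\<phi>|^(p-2). Bumps may touch, and then their masses at the common end point add up.\<close>

definition energy :: "real \<Rightarrow> real \<Rightarrow> real \<Rightarrow> real \<Rightarrow> real" where
  "energy p B c w = 8 * B + 4 * c * w - 8 / p * w powr (p / 2)"

lemma energy_0 [simp]: "energy p B c 0 = 8 * B"
  by (simp add: energy_def)

lemma continuous_energy: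
  assumes "p \<ge> 2"
  shows "continuous_on {0..} (energy p B c)"
  unfolding energy_def using assms
  by (intro continuous_intros continuous_on_powr') auto

lemma DERIV_energy:
  assumes "p \<ge> 2" "w > 0"
  shows "(energy p B c has_real_derivative 4 * c - 4 * w powr (p / 2 - 1)) (at w)"
  unfolding energy_def using assms
  by (auto intro!: derivative_eq_intros simp: field_simps)

text \<open>Concavity of \<open>energy\<close>, inherited from the convexity of the power with
  exponent p / 2 and written without denominators. Chords that start at 0 are left to
  \<open>energy_chord_0\<close>.\<close>

lemma energy_chord:
  assumes p: "p \<ge> 2" and "0 < a" "a < b" and w: "a \<le> w" "w \<le> b"
  shows "(b - w) * energy p B c a + (w - a) * energy p B c b \<le> (b - a) * energy p B c w"
proof -
  define t where "t = (w - a) / (b - a)"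
  have t: "0 \<le> t" "t \<le> 1" "(b - a) * t = w - a" "(b - a) * (1 - t) = b - w"
    using assms by (auto simp: t_def field_simps)
  have wt: "(1 - t) *\<^sub>R a + t *\<^sub>R b = w"
    using t(3) by (simp add: algebra_simps)
  have "convex_on {0<..} (\<lambda>x. x powr (p / 2))"
    using p by (intro powr_convex) auto
  then have "w powr (p / 2) \<le> (1 - t) * a powr (p / 2) + t * b powr (p / 2)"
    using convex_onD[of "{0<..}" "\<lambda>x. x powr (p / 2)" t a b] t(1,2) assms wt by auto
  then have "(b - a) * w powr (p / 2) \<le> (b - a) * ((1 - t) * a powr (p / 2) + t * b powr (p / 2))"
    using assms by (intro mult_left_mono) auto
  also have "\<dots> = ((b - a) * (1 - t)) * a powr (p / 2) + ((b - a) * t) * b powr (p / 2)"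
    by (simp add: algebra_simps)
  finally have "(b - a) * w powr (p / 2) \<le> (b - w) * a powr (p / 2) + (w - a) * b powr (p / 2)"
    by (simp only: t(3,4))
  then have "8 / p * ((b - a) * w powr (p / 2))
      \<le> 8 / p * ((b - w) * a powr (p / 2) + (w - a) * b powr (p / 2))"
    using p by (intro mult_left_mono) auto
  moreover define k where "k = 8 / p"
  ultimately show ?thesis
    unfolding energy_def by (fold k_def) (simp add: algebra_simps)
qed

text \<open>The quotient G(w) / w = 8 B / w + 4 c - (8 / p) w^(p/2 - 1) is nonincreasing, because
  \<open>B \<ge> 0\<close> and the exponent p / 2 - 1 is nonnegative.\<close>

lemma energy_chord_0:
  assumes p: "p \<ge> 2" and B: "B \<ge> 0" and w: "0 < w" "w \<le> b"
  shows "w * energy p B c b \<le> b * energy p B c w"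
proof -
  have *: "x powr (p / 2) = x * x powr (p / 2 - 1)" if "x > 0" for x :: real
    using that by (simp add: powr_mult_base)
  have "w powr (p / 2 - 1) \<le> b powr (p / 2 - 1)"
    using assms by (intro powr_mono2) auto
  then have "(8 / p * (b * w)) * w powr (p / 2 - 1) \<le> (8 / p * (b * w)) * b powr (p / 2 - 1)"
    using assms by (intro mult_left_mono) auto
  moreover have "w * B \<le> b * B"
    using B w by (intro mult_right_mono) auto
  ultimately show ?thesis
    unfolding energy_def using w by (simp add: * algebra_simps)
qed

text \<open>For \<open>B > 0\<close> positivity near 0 is continuity. For \<open>B = 0\<close> the
  value at 0 is no help, but G(w) / w tends to 4 c > 0; admissibility gives \<open>p > 2\<close>
  here, so the remaining power vanishes at 0.\<close>

lemma energy_pos_somewhere: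
  assumes p: "p \<ge> 2" and "admissible p B c"
  obtains w where "w > 0" "energy p B c w > 0"
proof (cases "B > 0")
  case True
  have "continuous (at 0 within {0..}) (energy p B c)"
    using continuous_energy[OF p] by (auto simp: continuous_on_eq_continuous_within)
  then have "(energy p B c \<longlongrightarrow> 8 * B) (at_right 0)"
    by (metis continuous_within energy_0 tendsto_within_subset greaterThan_subset_iff
        atLeast_subset_iff greaterThan_def atLeast_def Collect_mono less_imp_le)
  then have "eventually (\<lambda>w. energy p B c w > 0) (at_right 0)"
    by (rule order_tendstoD) (use True in simp)
  then have "eventually (\<lambda>w. energy p B c w > 0 \<and> w > 0) (at_right 0)"
    using eventually_at_right_less[of "0::real"] by eventually_elim auto
  then show ?thesis
    using that by (metis (mono_tags, lifting) eventually_happens' trivial_limit_at_right_real)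
next
  case False
  then have Bc: "B = 0" "c > 0" "p > 2"
    using assms by (auto simp: admissible_def)
  have "((\<lambda>w. 4 * c - 8 / p * w powr (p / 2 - 1)) \<longlongrightarrow> 4 * c - 8 / p * 0 powr (p / 2 - 1)) (at_right 0)"
    using Bc by (intro tendsto_intros) (auto intro: eventually_at_rightI[of 0 1])
  then have "eventually (\<lambda>w. 4 * c - 8 / p * w powr (p / 2 - 1) > 0) (at_right 0)"
  by (rule order_tendstoD) (use Bc in simp)
  then have "eventually (\<lambda>w. 4 * c - 8 / p * w powr (p / 2 - 1) > 0 \<and> w > 0) (at_right 0)"
    using eventually_at_right_less[of "0::real"] by eventually_elim auto
  then obtain w where w: "4 * c - 8 / p * w powr (p / 2 - 1) > 0" "w > 0"
    by (metis (mono_tags, lifting) eventually_happens' trivial_limit_at_right_real)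
  have "w powr (p / 2) = w * w powr (p / 2 - 1)"
    using w by (simp add: powr_mult_base)
  then have "energy p B c w = w * (4 * c - 8 / p * w powr (p / 2 - 1))"
    using Bc unfolding energy_def by (simp add: algebra_simps)
  then show ?thesis
    using that w by simp
qed

lemma energy_neg_eventually:
  assumes p: "p \<ge> 2" and "admissible p B c"
  shows "eventually (\<lambda>w. energy p B c w < 0) at_top"
proof (cases "p = 2")
  case True
  then have "c < 1" "B > 0"
    using assms by (auto simp: admissible_def)
  \<comment> \<open>For \<open>p = 2\<close> the energy is affine, 8 B - 4 (1 - c) w, with this
    zero.\<close>
  have "energy p B c w < 0" if "w > 2 * B / (1 - c)" for w
  proof -
    have "w > 0"
      using that \<open>c < 1\<close> \<open>B > 0\<close> by (smt (verit) divide_pos_pos)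
    then show ?thesis
      using that \<open>c < 1\<close> True by (simp add: energy_def field_simps)
  qed
  then show ?thesis
    by (rule eventually_mono[OF eventually_gt_at_top])
next
  case False
  then have "p > 2" using p by simp
  then have "filterlim (\<lambda>w::real. w powr (p / 2 - 1)) at_top at_top"
    by real_asymp
  then have "eventually (\<lambda>w. w powr (p / 2 - 1) > p / 8 * (8 * \<bar>B\<bar> + 4 * \<bar>c\<bar>)) at_top"
    by (rule filterlim_at_top_dense[THEN iffD1, rule_format])
  then show ?thesis
    using eventually_ge_at_top[of 1]
  proof eventually_elim
    case (elim w)
    have "w powr (p / 2) = w * w powr (p / 2 - 1)"
      using elim by (simp add: powr_mult_base)
    have "8 / p * w powr (p / 2 - 1) > 8 * \<bar>B\<bar> + 4 * \<bar>c\<bar>"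
      using elim p by (simp add: field_simps)
    then have "w * (8 / p * w powr (p / 2 - 1)) > w * (8 * \<bar>B\<bar> + 4 * \<bar>c\<bar>)"
      using elim by (intro mult_strict_left_mono) auto
    moreover have "w * \<bar>B\<bar> \<ge> B"
      using elim mult_right_mono[of 1 w "\<bar>B\<bar>"] by linarith
    moreover have "w * \<bar>c\<bar> \<ge> w * c"
      using elim by (intro mult_left_mono) auto
    ultimately show ?case
      unfolding energy_def \<open>w powr (p / 2) = _\<close> by (simp add: algebra_simps)
  qed
qed

text \<open>On (0, M) the concave function lies above the tent with vertices (0, 0), (w0, G(w0)) and
  (M, 0), and the tent lies above a parabola vanishing at 0 and \<open>M\<close>.\<close>

lemma energy_well:
  assumes p: "p \<ge> 2" and adm: "admissible p B c"
  obtains M C where "M > 0" "C > 0" "energy p B c M = 0"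
    "\<And>w. 0 < w \<Longrightarrow> w < M \<Longrightarrow> C * w * (M - w) \<le> energy p B c w"
proof -
  let ?G = "energy p B c"
  have B: "B \<ge> 0"
    using adm by (auto simp: admissible_def)
  obtain w0 where w0: "w0 > 0" "?G w0 > 0"
    using energy_pos_somewhere[OF p adm] .
  obtain w1 where w1: "w1 > w0" "?G w1 < 0"
    using eventually_conj[OF energy_neg_eventually[OF p adm] eventually_gt_at_top[of w0]]
    by (auto dest!: eventually_happens)
  have "\<exists>M. w0 \<le> M \<and> M \<le> w1 \<and> ?G M = 0"
    using w0 w1 by (intro IVT2' continuous_on_subset[OF continuous_energy[OF p]]) auto
  then obtain M where M: "w0 \<le> M" "?G M = 0" by blast
  have "w0 < M" using M w0 by (cases "w0 = M") auto
  \<comment> \<open>The tent has slopes G(w0) / w0 and G(w0) / (M - w0) in absolute value, both at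
    least G(w0) / M. On each side the missing factor, (M - w) / M or w / M, is at most 1.\<close>
  define C where "C = ?G w0 / (M * M)"
  have bound: "C * w * (M - w) \<le> ?G w" if w: "0 < w" "w < M" for w
  proof (cases "w0 \<le> w")
    case True
    have ch: "(M - w) * ?G w0 \<le> (M - w0) * ?G w"
      using energy_chord[OF p w0(1) \<open>w0 < M\<close> True, of B c] M w by simp
    moreover have "0 \<le> (M - w) * ?G w0"
      using w w0 by simp
    ultimately have "w * ((M - w) * ?G w0) \<le> M * ((M - w0) * ?G w)"
      using w by (metis less_imp_le mult_mono order_trans)
    also have "\<dots> \<le> M * (M * ?G w)"
    proof -
      have "(M - w0) * ?G w \<ge> 0"
        using ch \<open>0 \<le> (M - w) * ?G w0\<close> by linarith
      then have "?G w \<ge> 0"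
        using \<open>w0 < M\<close> by (simp add: zero_le_mult_iff)
      then show ?thesis
        using w w0 by (intro mult_left_mono mult_right_mono) auto
    qed
    finally show ?thesis
      unfolding C_def using w by (simp add: field_simps)
  next
    case False
    then have ch: "w * ?G w0 \<le> w0 * ?G w"
      using energy_chord_0[OF p B w(1), of w0 c] by auto
    then have "0 \<le> ?G w"
      using w w0 by (smt (verit) mult_nonneg_nonneg zero_le_mult_iff)
    have "(M - w) * (w * ?G w0) \<le> M * (w0 * ?G w)"
    proof (rule mult_mono[OF _ ch])
    qed (use w w0 in auto)
    also have "\<dots> \<le> M * (M * ?G w)"
      using \<open>0 \<le> ?G w\<close> w \<open>w0 < M\<close> by (intro mult_left_mono mult_right_mono) auto
    finally show ?thesis
      unfolding C_def using w by (simp add: field_simps)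
  qed
  show ?thesis
    using that[of M C] bound w0 \<open>w0 < M\<close> M by (auto simp: C_def)
qed

section \<open>Solution by quadrature\<close>

text \<open>Separation of variables for Y' = 1 / f(Y): the primitive \<open>T\<close> of
  \<open>f\<close> is the time at which a position is reached, and \<open>Y\<close> is its inverse.
  The bound on \<open>f\<close> is the derivative of \<open>K * arcsin (y / a)\<close>, so the end
  position \<open>a\<close> is reached in finite time.\<close>

lemma inverse_of_odd_primitive:
  fixes f :: "real \<Rightarrow> real"
  assumes a: "a > 0"
    and cont: "\<And>y. \<bar>y\<bar> < a \<Longrightarrow> isCont f y"
    and pos: "\<And>y. \<bar>y\<bar> < a \<Longrightarrow> f y > 0"
    and even: "\<And>y. f (- y) = f y"
    and bound: "\<And>y. \<bar>y\<bar> < a \<Longrightarrow> f y \<le> K / sqrt (a\<^sup>2 - y\<^sup>2)"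
  obtains X Y where "X > 0"
    "\<And>x. \<bar>x\<bar> < X \<Longrightarrow> \<bar>Y x\<bar> < a"
    "\<And>x. \<bar>x\<bar> < X \<Longrightarrow> (Y has_real_derivative 1 / f (Y x)) (at x)"
    "\<And>x. \<bar>x\<bar> < X \<Longrightarrow> Y (- x) = - Y x"
    "strict_mono_on {-X<..<X} Y"
    "(Y \<longlongrightarrow> a) (at_left X)"
proof -
  have "\<exists>F. \<forall>x :: real. ereal (- a) < x \<longrightarrow> x < ereal a \<longrightarrow> (F has_vector_derivative f x) (at x)"
    using a cont by (intro einterval_antiderivative) auto
  then obtain F where "\<And>y. - a < y \<Longrightarrow> y < a \<Longrightarrow> (F has_vector_derivative f y) (at y)"
    by auto
  then have F: "(F has_real_derivative f y) (at y)" if "\<bar>y\<bar> < a" for y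
    using that by (auto simp: has_real_derivative_iff_has_vector_derivative abs_less_iff)
  define T where "T y = F y - F 0" for y
  have T: "(T has_real_derivative f y) (at y)" if "\<bar>y\<bar> < a" for y
    using F[OF that] unfolding T_def by (auto intro!: derivative_eq_intros)
  have T0: "T 0 = 0" by (simp add: T_def)
  have mono: "T y < T z" if "\<bar>y\<bar> < a" "\<bar>z\<bar> < a" "y < z" for y z
    using that T pos by (intro DERIV_pos_imp_increasing[OF that(3)]) (smt (verit))
  have inj: "inj_on T {-a<..<a}"
    using mono by (intro linorder_inj_onI) (auto simp: abs_less_iff, force)
  have odd: "T (- y) = - T y" if "\<bar>y\<bar> < a" for y
  proof -
    \<comment> \<open>Since \<open>f\<close> is even, T(y) + T(-y) is constant, and it vanishes at
      0.\<close>
    have "((\<lambda>y. T y + T (- y)) has_real_derivative 0) (at z)" if "z \<in> {-a<..<a}" for z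
    proof -
      have "(T has_real_derivative f z) (at (- z))"
        using T[of "- z"] that by (simp add: even abs_less_iff)
      then have "((\<lambda>y. T (- y)) has_real_derivative - f z) (at z)"
        using DERIV_mirror by blast
      moreover have "(T has_real_derivative f z) (at z)"
        using T[of z] that by auto
      ultimately show ?thesis
        using DERIV_add by fastforce
    qed
    then have "\<exists>c. \<forall>y\<in>{-a<..<a}. T y + T (- y) = c"
      by (intro has_field_derivative_zero_constant) (auto intro: DERIV_subset)
    then obtain c where c: "\<And>y. y \<in> {-a<..<a} \<Longrightarrow> T y + T (- y) = c"
      by blast
    have "y \<in> {-a<..<a}" "0 \<in> {-a<..<a}"
      using that a by auto
    from c[OF this(1)] c[OF this(2)] show ?thesis
      using T0 by simp
  qed
  have T_bdd: "T y \<le> K * (pi / 2)" if y: "\<bar>y\<bar> < a" for y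
  proof -
    have "K > 0"
    proof -
      have "0 < a * f 0" using pos[of 0] a by simp
      also have "\<dots> \<le> K" using bound[of 0] a by (simp add: field_simps)
      finally show ?thesis .
    qed
    show ?thesis
    proof (cases "y \<le> 0")
      case True
      then have "T y \<le> 0"
        using mono[of y 0] y a T0 by (cases "y = 0") auto
      then show ?thesis
        using \<open>K > 0\<close> pi_gt_zero by (smt (verit) mult_pos_pos half_gt_zero)
    next
      case False
      \<comment> \<open>The difference vanishes at 0 and has nonnegative derivative by the assumed
        bound.\<close>
      have "(\<lambda>z. K * arcsin (z / a) - T z) 0 \<le> (\<lambda>z. K * arcsin (z / a) - T z) y"
      proof (rule DERIV_nonneg_imp_nondecreasing[where f = "\<lambda>z. K * arcsin (z / a) - T z"])
        show "0 \<le> y" using False by simp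
      next
        fix z assume z: "0 \<le> z" "z \<le> y"
        then have za: "\<bar>z\<bar> < a" "-1 < z / a" "z / a < 1"
          using y a by (auto simp: field_simps)
        have "sqrt (a\<^sup>2 - z\<^sup>2) = a * sqrt (1 - (z / a)\<^sup>2)"
        proof -
          have "a\<^sup>2 - z\<^sup>2 = a\<^sup>2 * (1 - (z / a)\<^sup>2)"
            using a by (simp add: power_divide field_simps)
          then show ?thesis
            using a by (simp add: real_sqrt_mult)
        qed
        then have "((\<lambda>z. K * arcsin (z / a) - T z) has_real_derivative K / sqrt (a\<^sup>2 - z\<^sup>2) - f z) (at z)"
          using za T[of z] a by (auto intro!: derivative_eq_intros simp: field_simps)
        then show "\<exists>D. ((\<lambda>z. K * arcsin (z / a) - T z) has_real_derivative D) (at z) \<and> 0 \<le> D"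
          using bound[OF za(1)] by (intro exI[of _ "K / sqrt (a\<^sup>2 - z\<^sup>2) - f z"]) auto
      qed
      then have "T y \<le> K * arcsin (y / a)"
        by (simp add: T0)
      also have "\<dots> \<le> K * (pi / 2)"
        using y a \<open>K > 0\<close> by (intro mult_left_mono arcsin_ubound) (auto simp: field_simps)
      finally show ?thesis .
    qed
  qed
  define X where "X = Sup (T ` {-a<..<a})"
  have bdd: "bdd_above (T ` {-a<..<a})"
    using T_bdd by (auto intro!: bdd_aboveI[of _ "K * (pi / 2)"])
  have T_less: "T y < X" if "\<bar>y\<bar> < a" for y
  proof -
    \<comment> \<open>A point strictly between |y| and \<open>a\<close> shows that the supremum is
      not attained.\<close>
    have "T y < T ((\<bar>y\<bar> + a) / 2)"
      using that by (intro mono) (auto simp: abs_if)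
    also have "\<dots> \<le> X"
      unfolding X_def using that bdd by (intro cSup_upper) auto
    finally show ?thesis .
  qed
  have X: "X > 0"
    using T_less[of 0] T0 a by simp
  have T_abs: "\<bar>T y\<bar> < X" if "\<bar>y\<bar> < a" for y
    using T_less[of y] T_less[of "- y"] odd[OF that] that by auto
  have surj: "\<exists>y. \<bar>y\<bar> < a \<and> T y = x" if "\<bar>x\<bar> < X" for x
  proof -
    have "\<exists>y\<in>{-a<..<a}. \<bar>x\<bar> < T y"
      using that a bdd less_cSup_iff[of "T ` {-a<..<a}" "\<bar>x\<bar>"] unfolding X_def by auto
    then obtain y where "y \<in> {-a<..<a}" and "\<bar>x\<bar> < T y"
      by blast
    then have y: "\<bar>y\<bar> < a" "\<bar>x\<bar> < T y"
      by auto
    then have "T (- y) < x" "x < T y" "y > 0"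
      using odd[of y] mono[of y 0] T0 a by (auto simp: abs_less_iff) (smt (verit))
    moreover have "continuous_on {-y..y} T"
    proof (rule continuous_at_imp_continuous_on, rule ballI)
      fix z assume "z \<in> {-y..y}"
      then show "isCont T z"
        using y by (intro DERIV_isCont[OF T]) auto
    qed
    ultimately have "\<exists>z. - y \<le> z \<and> z \<le> y \<and> T z = x"
      by (intro IVT') auto
    then obtain z where "- y \<le> z" "z \<le> y" "T z = x" by blast
    then show ?thesis
      using y by (intro exI[of _ z]) auto
  qed
  define Y where "Y = inv_into {-a<..<a} T"
  have YT: "Y (T y) = y" if "\<bar>y\<bar> < a" for y
    unfolding Y_def using inj that by (intro inv_into_f_f) auto
  have TY: "\<bar>Y x\<bar> < a" "T (Y x) = x" if "\<bar>x\<bar> < X" for x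
    using surj[OF that] YT by auto
  have Yder: "(Y has_real_derivative 1 / f (Y x)) (at x)" if x: "\<bar>x\<bar> < X" for x
  proof -
    have "continuous_on {-a<..<a} T"
      by (intro continuous_at_imp_continuous_on ballI DERIV_isCont[OF T]) auto
    moreover have "f (Y x) \<noteq> 0"
      using pos[OF TY(1)[OF x]] by simp
    ultimately have "(Y has_derivative (*) (1 / f (Y x))) (at x)"
      using TY[OF x] YT T[OF TY(1)[OF x]]
      by (intro has_derivative_inverse_strong_x[of "{-a<..<a}" Y x T "(*) (f (Y x))"])
         (auto simp: has_field_derivative_def fun_eq_iff)
    then show ?thesis
      by (simp add: has_field_derivative_def)
  qed
  have Ymono: "Y x < Y z" if "\<bar>x\<bar> < X" "\<bar>z\<bar> < X" "x < z" for x z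
    using that TY mono by (metis not_less_iff_gr_or_eq)
  have "(Y \<longlongrightarrow> a) (at_left X)"
  proof (rule order_tendstoI)
    fix b assume "b > a"
    then show "eventually (\<lambda>x. Y x < b) (at_left X)"
      using TY(1) X by (intro eventually_at_leftI[of "- X"]) (auto simp: abs_less_iff, force)
  next
    fix b assume b: "b < a"
    \<comment> \<open>The maximum keeps the comparison point inside (-a, a) even when
      \<open>b\<close> lies below -a.\<close>
    define y where "y = max b 0"
    have y: "\<bar>y\<bar> < a" "b \<le> y"
      using b a by (auto simp: y_def)
    have "b < Y x" if "x \<in> {T y<..<X}" for x
    proof -
      have "\<bar>x\<bar> < X" using that T_abs[OF y(1)] by auto
      then show ?thesis
        using Ymono[OF T_abs[OF y(1)], of x] that YT[OF y(1)] y(2) by auto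
    qed
    then show "eventually (\<lambda>x. b < Y x) (at_left X)"
      using T_less[OF y(1)] by (intro eventually_at_leftI) auto
  qed
  moreover have "Y (- x) = - Y x" if "\<bar>x\<bar> < X" for x
    using TY[OF that] odd[of "Y x"] YT[of "- Y x"] by auto
  moreover have "strict_mono_on {-X<..<X} Y"
    using Ymono by (intro strict_mono_onI) (auto simp: abs_less_iff)
  ultimately show ?thesis
    using that[OF X, of Y] TY Yder by blast
qed

text \<open>Newton's law u' = G'(w) / 2 is part of the conclusion because it does not follow at x =
  0 from the energy identity: differentiating (u)^2 = G(w) allows division by \<open>u\<close> only
  away from the turning point.\<close>

lemma even_orbit_in_potential_well:
  fixes G G' :: "real \<Rightarrow> real"
  assumes M: "M > 0" and C: "C > 0" and GM: "G M = 0"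
    and bound: "\<And>w. 0 < w \<Longrightarrow> w < M \<Longrightarrow> C * w * (M - w) \<le> G w"
    and der: "\<And>w. w > 0 \<Longrightarrow> (G has_real_derivative G' w) (at w)"
    and contG: "continuous_on {0..} G"
  obtains X w u where "X > 0"
    "\<And>x. \<bar>x\<bar> < X \<Longrightarrow> w x > 0"
    "\<And>x. \<bar>x\<bar> < X \<Longrightarrow> w (- x) = w x"
    "\<And>x. \<bar>x\<bar> < X \<Longrightarrow> u (- x) = - u x"
    "\<And>x. \<bar>x\<bar> < X \<Longrightarrow> (w has_real_derivative u x) (at x)"
    "\<And>x. \<bar>x\<bar> < X \<Longrightarrow> (u has_real_derivative G' (w x) / 2) (at x)"
    "\<And>x. \<bar>x\<bar> < X \<Longrightarrow> (u x)\<^sup>2 = G (w x)"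
    "\<And>x. 0 < x \<Longrightarrow> x < X \<Longrightarrow> u x < 0"
    "(w \<longlongrightarrow> 0) (at_left X)"
    "(u \<longlongrightarrow> - sqrt (G 0)) (at_left X)"
proof -
  define a where "a = sqrt M"
  have a: "a > 0" "a\<^sup>2 = M"
    using M by (auto simp: a_def)
  have sq: "0 < M - y\<^sup>2" if "\<bar>y\<bar> < a" for y
    using power_strict_mono[of "\<bar>y\<bar>" a 2] that a by simp
  \<comment> \<open>With w = M - y^2 the quotient is G(w) / (M - w), whose limit as \<open>w\<close>
    tends to \<open>M\<close> is -G'(M).\<close>
  define h where "h y = (if y = 0 then - G' M else G (M - y\<^sup>2) / y\<^sup>2)" for y
  have hG: "y\<^sup>2 * h y = G (M - y\<^sup>2)" for y
    by (simp add: h_def GM)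
  have isCont_G: "isCont G w" if "w > 0" for w
    using der[OF that] by (rule DERIV_isCont)
  have h_bound: "C * (M - y\<^sup>2) \<le> h y" if "y \<noteq> 0" "\<bar>y\<bar> < a" for y
    using bound[OF sq[OF that(2)]] that(1) by (simp add: h_def field_simps)
  have lim_h: "(h \<longlongrightarrow> - G' M) (at 0)"
  proof -
    have "((\<lambda>w. (G w - G M) / (w - M)) \<longlongrightarrow> G' M) (at M)"
      using der[OF M] by (simp add: has_field_derivative_iff)
    moreover have "filterlim (\<lambda>y::real. M - y\<^sup>2) (at M) (at 0)"
    proof (rule filterlim_atI)
      show "((\<lambda>y. M - y\<^sup>2) \<longlongrightarrow> M) (at 0)"
        by (auto intro!: tendsto_eq_intros)
      show "eventually (\<lambda>y. M - y\<^sup>2 \<noteq> M) (at 0)"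
        by (auto simp: eventually_at_filter)
    qed
    ultimately have "((\<lambda>y. (G (M - y\<^sup>2) - G M) / (M - y\<^sup>2 - M)) \<longlongrightarrow> G' M) (at 0)"
      by (rule filterlim_compose)
    then have "((\<lambda>y. - ((G (M - y\<^sup>2) - G M) / (M - y\<^sup>2 - M))) \<longlongrightarrow> - G' M) (at 0)"
      by (rule tendsto_minus)
    then show ?thesis
      by (rule Lim_transform_eventually) (auto simp: eventually_at_filter h_def GM)
  qed
  \<comment> \<open>Passing to the limit in the lower bound shows that \<open>M\<close> is a simple
    zero of \<open>G\<close>, hence that \<open>h\<close> is positive at 0 as well.\<close>
  have "C * (M - 0\<^sup>2) \<le> - G' M"
  proof (rule tendsto_le[OF _ lim_h])
    show "((\<lambda>y. C * (M - y\<^sup>2)) \<longlongrightarrow> C * (M - 0\<^sup>2)) (at 0)"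
      by (intro tendsto_intros)
    have "eventually (\<lambda>y. y \<noteq> 0 \<and> \<bar>y\<bar> < a) (at 0)"
      using a by (auto simp: eventually_at)
    then show "eventually (\<lambda>y. C * (M - y\<^sup>2) \<le> h y) (at 0)"
      by eventually_elim (auto intro: h_bound)
  qed auto
  then have h_bound: "C * (M - y\<^sup>2) \<le> h y" if "\<bar>y\<bar> < a" for y
    using h_bound[of y] that by (cases "y = 0") (auto simp: h_def)
  have h_pos: "h y > 0" if "\<bar>y\<bar> < a" for y
    using h_bound[OF that] sq[OF that] C by (smt (verit) mult_pos_pos)
  have h_cont: "isCont h y" if "\<bar>y\<bar> < a" for y
  proof (cases "y = 0")
    case True
    then show ?thesis
      using lim_h by (simp add: isCont_def h_def)
  next
    case False
    have "isCont (\<lambda>y. M - y\<^sup>2) y"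
      by (intro continuous_intros)
    then have "isCont (\<lambda>y. G (M - y\<^sup>2)) y"
      using isCont_G[OF sq[OF that]] by (rule isCont_o2)
    then have "isCont (\<lambda>y. G (M - y\<^sup>2) / y\<^sup>2) y"
      using False by (intro continuous_intros) auto
    moreover have "eventually (\<lambda>z. z \<noteq> 0) (nhds y)"
      using False t1_space_nhds by blast
    then have "eventually (\<lambda>z. h z = G (M - z\<^sup>2) / z\<^sup>2) (nhds y)"
      by eventually_elim (simp add: h_def)
    ultimately show ?thesis
      by (simp add: isCont_cong)
  qed
  \<comment> \<open>From w' = -2 y y' and (w')^2 = y^2 h(y) comes y' = sqrt(h(y)) / 2, so the
    integrand of the quadrature is 2 / sqrt(h). Its bound has the arcsine form because M =
    a^2.\<close>
  have h_le: "2 / sqrt (h y) \<le> (2 / sqrt C) / sqrt (a\<^sup>2 - y\<^sup>2)" if "\<bar>y\<bar> < a" for y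
  proof -
    have "sqrt C * sqrt (a\<^sup>2 - y\<^sup>2) \<le> sqrt (h y)"
      using h_bound[OF that] a by (simp flip: real_sqrt_mult)
    moreover have "0 < sqrt C * sqrt (a\<^sup>2 - y\<^sup>2)"
      using sq[OF that] a C by simp
    ultimately have "2 / sqrt (h y) \<le> 2 / (sqrt C * sqrt (a\<^sup>2 - y\<^sup>2))"
      by (smt (verit) frac_le)
    then show ?thesis by simp
  qed
  have "isCont (\<lambda>y. 2 / sqrt (h y)) y" if "\<bar>y\<bar> < a" for y
    using h_pos[OF that] h_cont[OF that] by (intro continuous_intros) auto
  moreover have "2 / sqrt (h y) > 0" if "\<bar>y\<bar> < a" for y
    using h_pos[OF that] by simp
  moreover have "2 / sqrt (h (- y)) = 2 / sqrt (h y)" for y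
    by (simp add: h_def)
  ultimately obtain X Y where X: "X > 0"
    and Y: "\<And>x. \<bar>x\<bar> < X \<Longrightarrow> \<bar>Y x\<bar> < a"
    and Yder0: "\<And>x. \<bar>x\<bar> < X \<Longrightarrow> (Y has_real_derivative 1 / (2 / sqrt (h (Y x)))) (at x)"
    and Yodd: "\<And>x. \<bar>x\<bar> < X \<Longrightarrow> Y (- x) = - Y x"
    and Ymono: "strict_mono_on {-X<..<X} Y"
    and Ylim: "(Y \<longlongrightarrow> a) (at_left X)"
    using inverse_of_odd_primitive[OF a(1), of "\<lambda>y. 2 / sqrt (h y)" "2 / sqrt C"] h_le by metis
  have Yder: "(Y has_real_derivative sqrt (h (Y x)) / 2) (at x)" if "\<bar>x\<bar> < X" for x
    using Yder0[OF that] by simp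
  have Y0: "Y 0 = 0"
    using Yodd[of 0] X by simp
  have Ypos: "Y x > 0" if "0 < x" "x < X" for x
    using strict_mono_onD[OF Ymono, of 0 x] that Y0 by simp
  define w where "w x = M - (Y x)\<^sup>2" for x
  \<comment> \<open>This is w' = -2 Y Y'.\<close>
  define u where "u x = - Y x * sqrt (h (Y x))" for x
  have w_pos: "w x > 0" if "\<bar>x\<bar> < X" for x
    unfolding w_def by (intro sq Y that)
  have w_der: "(w has_real_derivative u x) (at x)" if "\<bar>x\<bar> < X" for x
    unfolding w_def u_def using Yder[OF that] by (auto intro!: derivative_eq_intros)
  have u_sq: "(u x)\<^sup>2 = G (w x)" if "\<bar>x\<bar> < X" for x
    using h_pos[OF Y[OF that]] hG[of "Y x"] by (simp add: u_def w_def power_mult_distrib)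
  have u_odd: "u (- x) = - u x" if "\<bar>x\<bar> < X" for x
    using Yodd[OF that] by (simp add: u_def h_def)
  have u_neg: "u x < 0" if "0 < x" "x < X" for x
    using Ypos[OF that] h_pos[OF Y[of x]] that by (simp add: u_def)
  have u_sqrt: "u x = - sqrt (G (w x))" if "0 < x" "x < X" for x
    using u_neg[OF that] u_sq[of x] that by (smt (verit) real_sqrt_abs)
  have u_der_pos: "(u has_real_derivative G' (w x) / 2) (at x)" if x: "0 < x" "x < X" for x
  proof -
    have Gw: "G (w x) > 0"
      using u_neg[OF x] u_sq[of x] x by (smt (verit) zero_less_power2)
    have "((\<lambda>x. G (w x)) has_real_derivative G' (w x) * u x) (at x)"
      using der[OF w_pos] w_der x by (intro DERIV_chain2[where f = G and g = w]) auto
    then have "((\<lambda>x. sqrt (G (w x))) has_real_derivative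
        inverse (sqrt (G (w x))) / 2 * (G' (w x) * u x)) (at x)"
      by (intro DERIV_chain2[where f = sqrt and g = "\<lambda>x. G (w x)"] DERIV_real_sqrt Gw)
    then have "((\<lambda>x. - sqrt (G (w x))) has_real_derivative
        - (inverse (sqrt (G (w x))) / 2 * (G' (w x) * u x))) (at x)"
      by (rule DERIV_minus)
    \<comment> \<open>On the right half u = -sqrt(G(w)), so \<open>u\<close> cancels against the
      inverse square root and leaves a plus sign.\<close>
    moreover have "- (inverse (sqrt (G (w x))) / 2 * (G' (w x) * u x)) = G' (w x) / 2"
      using Gw by (simp add: u_sqrt[OF x])
    ultimately have "((\<lambda>x. - sqrt (G (w x))) has_real_derivative G' (w x) / 2) (at x)"
      by (simp only:)
    then show ?thesis
      by (rule has_field_derivative_transform_within_open[of _ _ _ "{0<..<X}"])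
         (use x in \<open>auto simp: u_sqrt\<close>)
  qed
  have u_der: "(u has_real_derivative G' (w x) / 2) (at x)" if x: "\<bar>x\<bar> < X" for x
  proof -
    consider "x > 0" | "x < 0" | "x = 0" by linarith
    then show ?thesis
    proof cases
      case 1
      then show ?thesis using u_der_pos x by simp
    next
      case 2
      have "(u has_real_derivative G' (w x) / 2) (at (- x))"
        using u_der_pos[of "- x"] 2 x Yodd[OF x] by (simp add: w_def)
      then have "((\<lambda>x. u (- x)) has_real_derivative - (G' (w x) / 2)) (at x)"
        using DERIV_mirror by blast
      then have "((\<lambda>x. - u (- x)) has_real_derivative G' (w x) / 2) (at x)"
        by (auto intro!: derivative_eq_intros)
      then show ?thesis
        by (rule has_field_derivative_transform_within_open[of _ _ _ "{-X<..<X}"])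
           (use x in \<open>auto simp: u_odd\<close>)
    next
      case 3
      have "((\<lambda>x. (Y x - Y 0) / (x - 0)) \<longlongrightarrow> sqrt (h (Y 0)) / 2) (at 0)"
        using Yder[of 0] X by (simp add: has_field_derivative_iff)
      moreover have "((\<lambda>x. sqrt (h (Y x))) \<longlongrightarrow> sqrt (h (Y 0))) (at 0)"
      proof -
        have "isCont Y 0"
          using Yder[of 0] X by (intro DERIV_isCont) auto
        then have "isCont (\<lambda>x. h (Y x)) 0"
          by (rule isCont_o2) (use h_cont[of "Y 0"] a Y0 in simp)
        then show ?thesis
          by (intro tendsto_real_sqrt) (simp add: isCont_def)
      qed
      ultimately have "((\<lambda>x. - ((Y x - Y 0) / (x - 0)) * sqrt (h (Y x))) \<longlongrightarrow>
          - (sqrt (h (Y 0)) / 2) * sqrt (h (Y 0))) (at 0)"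
        by (rule tendsto_mult[OF tendsto_minus])
      also have "- (sqrt (h (Y 0)) / 2) * sqrt (h (Y 0)) = G' (w 0) / 2"
        using h_pos[of 0] a by (simp add: Y0 w_def h_def)
      finally have "((\<lambda>x. (u x - u 0) / (x - 0)) \<longlongrightarrow> G' (w 0) / 2) (at 0)"
        by (simp add: Y0 u_def)
      then show ?thesis
        using 3 by (simp add: has_field_derivative_iff)
    qed
  qed
  have w_lim: "(w \<longlongrightarrow> 0) (at_left X)"
    using tendsto_diff[OF tendsto_const tendsto_power[OF Ylim, of 2], of M]
    by (simp add: w_def[abs_def] a)
  have u_lim: "(u \<longlongrightarrow> - sqrt (G 0)) (at_left X)"
  proof -
    have ev: "eventually (\<lambda>x. 0 < x \<and> x < X) (at_left X)"
      using X by (intro eventually_at_leftI[of 0]) auto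
    have "((\<lambda>x. G (w x)) \<longlongrightarrow> G 0) (at_left X)"
    proof (rule continuous_on_tendsto_compose[OF contG w_lim])
      show "eventually (\<lambda>x. w x \<in> {0..}) (at_left X)"
        using ev by eventually_elim (simp add: less_imp_le w_pos)
    qed auto
    then have "((\<lambda>x. - sqrt (G (w x))) \<longlongrightarrow> - sqrt (G 0)) (at_left X)"
      by (intro tendsto_intros)
    then show ?thesis
      by (rule Lim_transform_eventually) (use ev in \<open>eventually_elim, simp add: u_sqrt\<close>)
  qed
  have w_even: "w (- x) = w x" if "\<bar>x\<bar> < X" for x
    using Yodd[OF that] by (simp add: w_def)
  show ?thesis
    using that[of X w u] X w_pos w_even u_odd w_der u_der u_sq u_neg w_lim u_lim by blast
qed

section \<open>Smoothness\<close>

text \<open>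
  Smoothness of a solution \<open>f\<close> with \<open>f' = u / (2 f)\<close> and \<open>u' = k + l f\<^sup>r\<close>: the algebra generated by the
  constants, the powers of \<open>f\<close> and \<open>u\<close> is closed under differentiation.
\<close>

inductive derivation_closed :: "(real \<Rightarrow> real) \<Rightarrow> (real \<Rightarrow> real) \<Rightarrow> (real \<Rightarrow> real) \<Rightarrow> bool"
  for f u where
  const: "derivation_closed f u (\<lambda>x. k)"
| powr: "derivation_closed f u (\<lambda>x. f x powr r)"
| velocity: "derivation_closed f u u"
| add: "derivation_closed f u g \<Longrightarrow> derivation_closed f u h \<Longrightarrow> derivation_closed f u (\<lambda>x. g x + h x)"
| mult: "derivation_closed f u g \<Longrightarrow> derivation_closed f u h \<Longrightarrow> derivation_closed f u (\<lambda>x. g x * h x)"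

lemma derivation_closed_DERIV:
  assumes "derivation_closed f u h"
    and pos: "\<And>x. x \<in> S \<Longrightarrow> f x > 0"
    and f: "\<And>x. x \<in> S \<Longrightarrow> (f has_real_derivative u x / (2 * f x)) (at x)"
    and u: "\<And>x. x \<in> S \<Longrightarrow> (u has_real_derivative k + l * f x powr r) (at x)"
  shows "\<exists>h'. derivation_closed f u h' \<and> (\<forall>x\<in>S. (h has_real_derivative h' x) (at x))"
  using assms(1)
proof induction
  case (const k)
  then show ?case
    by (intro exI[of _ "\<lambda>x. 0"]) (auto intro: derivation_closed.const)
next
  case (powr s)
  \<comment> \<open>The division by \<open>f\<close> only lowers the exponent, and arbitrary real
    exponents belong to the algebra.\<close>
  have "((\<lambda>x. f x powr s) has_real_derivative s / 2 * (f x powr (s - 2) * u x)) (at x)" if "x \<in> S" for x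
  proof -
    have "((\<lambda>x. f x powr s) has_real_derivative s * f x powr (s - 1) * (u x / (2 * f x))) (at x)"
      using has_real_derivative_powr[OF pos[OF that]] f[OF that] by (rule DERIV_chain2)
    moreover have "f x powr (s - 1) = f x powr (s - 2) * f x"
      using pos[OF that] powr_mult_base[of "f x" "s - 2"] by (simp add: mult.commute)
    ultimately show ?thesis
      using pos[OF that] by simp
  qed
  moreover have "derivation_closed f u (\<lambda>x. s / 2 * (f x powr (s - 2) * u x))"
    by (intro derivation_closed.mult[OF derivation_closed.const]
        derivation_closed.mult[OF derivation_closed.powr derivation_closed.velocity])
  ultimately show ?case by blast
next
  case velocity
  have "derivation_closed f u (\<lambda>x. k + l * f x powr r)"
    by (intro derivation_closed.add[OF derivation_closed.const]
        derivation_closed.mult[OF derivation_closed.const derivation_closed.powr])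
  then show ?case
    using u by blast
next
  case (add g h)
  then obtain g' h' where "derivation_closed f u g'" "derivation_closed f u h'"
    "\<forall>x\<in>S. (g has_real_derivative g' x) (at x)" "\<forall>x\<in>S. (h has_real_derivative h' x) (at x)"
    by blast
  then have "\<forall>x\<in>S. ((\<lambda>x. g x + h x) has_real_derivative g' x + h' x) (at x)"
    "derivation_closed f u (\<lambda>x. g' x + h' x)"
    by (simp_all add: DERIV_add derivation_closed.add)
  then show ?case by blast
next
  case (mult g h)
  then obtain g' h' where "derivation_closed f u g'" "derivation_closed f u h'"
    "\<forall>x\<in>S. (g has_real_derivative g' x) (at x)" "\<forall>x\<in>S. (h has_real_derivative h' x) (at x)"
    by blast
  then have "\<forall>x\<in>S. ((\<lambda>x. g x * h x) has_real_derivative g' x * h x + h' x * g x) (at x)"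
    "derivation_closed f u (\<lambda>x. g' x * h x + h' x * g x)"
    using mult.hyps by (simp_all add: DERIV_mult derivation_closed.add derivation_closed.mult)
  then show ?case by blast
qed

text \<open>By induction every iterated derivative agrees on \<open>S\<close> with a member of the
  algebra. Openness of \<open>S\<close> lets this agreement pass to the next derivative.\<close>

lemma smooth_on_derivation_closed:
  assumes S: "open S"
    and pos: "\<And>x. x \<in> S \<Longrightarrow> f x > 0"
    and f: "\<And>x. x \<in> S \<Longrightarrow> (f has_real_derivative u x / (2 * f x)) (at x)"
    and u: "\<And>x. x \<in> S \<Longrightarrow> (u has_real_derivative k + l * f x powr r) (at x)"
  shows "smooth_on S f"
proof -
  have step: "\<exists>h'. derivation_closed f u h' \<and> (\<forall>x\<in>S. (g has_real_derivative h' x) (at x))"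
    if h: "derivation_closed f u h" and eq: "\<forall>x\<in>S. g x = h x" for g h
  proof -
    obtain h' where h': "derivation_closed f u h'" "\<forall>x\<in>S. (h has_real_derivative h' x) (at x)"
      using derivation_closed_DERIV[where S = S, OF h pos f u] by blast
    have "(g has_real_derivative h' x) (at x)" if "x \<in> S" for x
      by (rule has_field_derivative_transform_within_open[of h _ _ S])
         (use h'(2) eq S that in auto)
    with h'(1) show ?thesis by blast
  qed
  have iterated: "\<exists>h. derivation_closed f u h \<and> (\<forall>x\<in>S. (deriv ^^ n) f x = h x)" for n
  proof (induction n)
    case 0
    show ?case
    proof (intro exI conjI ballI)
      \<comment> \<open>On \<open>S\<close> the function \<open>f\<close> is its own first power
        because it is positive there.\<close>
      show "derivation_closed f u (\<lambda>x. f x powr 1)"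
        by (rule derivation_closed.powr)
      show "(deriv ^^ 0) f x = f x powr 1" if "x \<in> S" for x
        using pos[OF that] by simp
    qed
  next
    case (Suc n)
    then obtain h where "derivation_closed f u h" "\<forall>x\<in>S. (deriv ^^ n) f x = h x"
      by blast
    from step[OF this] obtain h' where h': "derivation_closed f u h'"
      "\<forall>x\<in>S. ((deriv ^^ n) f has_real_derivative h' x) (at x)"
      by blast
    then have "\<forall>x\<in>S. (deriv ^^ Suc n) f x = h' x"
      by (simp add: DERIV_imp_deriv)
    with h'(1) show ?case by blast
  qed
  show ?thesis
    unfolding smooth_on_def
  proof (intro allI ballI)
    fix n x assume "x \<in> S"
    obtain h where "derivation_closed f u h" "\<forall>x\<in>S. (deriv ^^ n) f x = h x"
      using iterated by blast
    from step[OF this] \<open>x \<in> S\<close> show "(deriv ^^ n) f differentiable (at x)"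
      unfolding real_differentiable_def by blast
  qed
qed

section \<open>Weak derivatives\<close>

text \<open>The class in which bumps are tested: integration by parts uses one continuous
  derivative, and the compact support comes from the bump instead of from \<psi>.\<close>

definition continuously_differentiable :: "(real \<Rightarrow> real) \<Rightarrow> bool" where
  "continuously_differentiable \<psi> \<longleftrightarrow>
    (\<forall>x. (\<psi> has_real_derivative deriv \<psi> x) (at x)) \<and> continuous_on UNIV (deriv \<psi>)"

lemma continuously_differentiable_imp_continuous:
  assumes "continuously_differentiable \<psi>"
  shows "continuous_on UNIV \<psi>"
  using assms DERIV_isCont unfolding continuously_differentiable_def
  by (blast intro: continuous_at_imp_continuous_on)

lemma continuously_differentiable_test_function:
  assumes "test_function \<psi>"
  shows "continuously_differentiable \<psi>"
proof -
  have "(deriv ^^ n) \<psi> differentiable (at x)" for n x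
    using assms by (auto simp: test_function_def smooth_on_def)
  from this[of 0] this[of 1] have "\<psi> differentiable (at x)" "deriv \<psi> differentiable (at x)" for x
    by simp_all
  moreover from this(2) have "continuous_on UNIV (deriv \<psi>)"
    by (intro continuous_at_imp_continuous_on ballI differentiable_imp_continuous_within)
  ultimately show ?thesis
    unfolding continuously_differentiable_def DERIV_deriv_iff_real_differentiable by blast
qed

lemma continuously_differentiable_translate:
  assumes "continuously_differentiable \<psi>"
  shows "continuously_differentiable (\<lambda>x. \<psi> (\<xi> + x))" "deriv (\<lambda>x. \<psi> (\<xi> + x)) = (\<lambda>x. deriv \<psi> (\<xi> + x))"
proof -
  have *: "((\<lambda>x. \<psi> (\<xi> + x)) has_real_derivative deriv \<psi> (\<xi> + x)) (at x)" for x
    using assms DERIV_shift[of \<psi> "deriv \<psi> (\<xi> + x)" x \<xi>]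
    by (simp add: continuously_differentiable_def add.commute)
  show **: "deriv (\<lambda>x. \<psi> (\<xi> + x)) = (\<lambda>x. deriv \<psi> (\<xi> + x))"
    by (rule ext) (rule DERIV_imp_deriv[OF *])
  have "continuous_on UNIV (\<lambda>x. deriv \<psi> (\<xi> + x))"
    by (rule continuous_on_compose2[of UNIV "deriv \<psi>"])
       (use assms in \<open>auto simp: continuously_differentiable_def intro!: continuous_intros\<close>)
  with * show "continuously_differentiable (\<lambda>x. \<psi> (\<xi> + x))"
    by (simp add: continuously_differentiable_def **)
qed

section \<open>Integrability and integration by parts on a bounded interval\<close>

lemma integrable_mult_continuous:
  fixes f \<psi> :: "real \<Rightarrow> real"
  assumes f: "integrable lborel f" and \<psi>: "continuous_on UNIV \<psi>"
    and 0: "\<And>x. x \<notin> {a..b} \<Longrightarrow> f x = 0"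
  shows "integrable lborel (\<lambda>x. f x * \<psi> x)"
proof -
  have "bounded (\<psi> ` {a..b})"
    by (intro compact_imp_bounded compact_continuous_image continuous_on_subset[OF \<psi>]) auto
  then obtain K where "\<forall>x\<in>{a..b}. \<bar>\<psi> x\<bar> \<le> K"
    by (auto simp: bounded_iff)
  then have K: "\<And>x. x \<in> {a..b} \<Longrightarrow> \<bar>\<psi> x\<bar> \<le> K"
    by blast
  have "integrable lborel (\<lambda>x. K * f x)"
    using f by simp
  then show ?thesis
  proof (rule Bochner_Integration.integrable_bound)
    show "(\<lambda>x. f x * \<psi> x) \<in> borel_measurable lborel"
      using f borel_measurable_continuous_onI[OF \<psi>] by simp
    have "\<bar>f x * \<psi> x\<bar> \<le> \<bar>K * f x\<bar>" for x
    proof (cases "x \<in> {a..b}")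
      case True
      have "\<bar>\<psi> x\<bar> \<le> \<bar>K\<bar>" using K[OF True] by linarith
      then have "\<bar>f x\<bar> * \<bar>\<psi> x\<bar> \<le> \<bar>f x\<bar> * \<bar>K\<bar>"
        by (intro mult_left_mono) auto
      then show ?thesis
        by (simp only: abs_mult mult.commute)
    qed (use 0 in simp)
    then show "AE x in lborel. norm (f x * \<psi> x) \<le> norm (K * f x)"
      by simp
  qed
qed

lemma integrable_continuous_on_interval:
  fixes f :: "real \<Rightarrow> real"
  assumes "continuous_on UNIV f" "\<And>x. x \<notin> {a..b} \<Longrightarrow> f x = 0"
  shows "integrable lborel f"
proof -
  have "integrable lborel (\<lambda>x. indicator {a..b} x *\<^sub>R f x)"
    by (intro borel_integrable_compact continuous_on_subset[OF assms(1)]) auto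
  also have "(\<lambda>x. indicator {a..b} x *\<^sub>R f x) = f"
  proof
    show "indicator {a..b} x *\<^sub>R f x = f x" for x
      by (cases "x \<in> {a..b}") (use assms(2)[of x] in auto)
  qed
  finally show ?thesis .
qed

text \<open>The fundamental theorem for F \<psi> on the open interval, with one-sided limits as
  boundary values. These limits are the jumps of the extension of \<open>F\<close> by zero.
  Integrability is a hypothesis since \<open>f\<close> may blow up at the ends, as \<phi>'
  does.\<close>

lemma integral_by_parts_with_jumps:
  fixes F f \<psi> :: "real \<Rightarrow> real"
  assumes ab: "a < b"
    and F: "\<And>x. a < x \<Longrightarrow> x < b \<Longrightarrow> (F has_real_derivative f x) (at x)"
    and f: "\<And>x. a < x \<Longrightarrow> x < b \<Longrightarrow> isCont f x"
    and 0: "\<And>x. \<not> (a < x \<and> x < b) \<Longrightarrow> F x = 0 \<and> f x = 0"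
    and int: "integrable lborel F" "integrable lborel f"
    and A: "(F \<longlongrightarrow> A) (at_right a)" and B: "(F \<longlongrightarrow> B) (at_left b)"
    and \<psi>: "continuously_differentiable \<psi>"
  shows "(LINT x|lborel. F x * deriv \<psi> x) = B * \<psi> b - A * \<psi> a - (LINT x|lborel. f x * \<psi> x)"
proof -
  let ?h = "\<lambda>x. f x * \<psi> x + F x * deriv \<psi> x"
  have \<psi>_der: "(\<psi> has_real_derivative deriv \<psi> x) (at x)" for x
    using \<psi> by (simp add: continuously_differentiable_def)
  have \<psi>_cont: "continuous_on UNIV \<psi>" "continuous_on UNIV (deriv \<psi>)"
    using continuously_differentiable_imp_continuous[OF \<psi>] \<psi>
    by (auto simp: continuously_differentiable_def)
  then have \<psi>_isCont: "isCont \<psi> x" "isCont (deriv \<psi>) x" for x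
    by (auto simp: continuous_on_eq_continuous_at)
  have i1: "integrable lborel (\<lambda>x. f x * \<psi> x)"
    by (rule integrable_mult_continuous[OF int(2) \<psi>_cont(1), of a b]) (use 0 in auto)
  have i2: "integrable lborel (\<lambda>x. F x * deriv \<psi> x)"
    by (rule integrable_mult_continuous[OF int(1) \<psi>_cont(2), of a b]) (use 0 in auto)
  have ind: "indicator {a<..<b} x *\<^sub>R ?h x = ?h x" for x
    by (cases "a < x \<and> x < b") (use 0[of x] in \<open>auto simp: indicator_def\<close>)
  have lims: "(\<psi> \<longlongrightarrow> \<psi> a) (at_right a)" "(\<psi> \<longlongrightarrow> \<psi> b) (at_left b)"
    using \<psi>_isCont(1)[of a] \<psi>_isCont(1)[of b]
    by (auto simp: isCont_def filterlim_at_split)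
  have "(LBINT x=ereal a..ereal b. ?h x) = B * \<psi> b - A * \<psi> a"
  proof (rule interval_integral_FTC_integrable[where F = "\<lambda>x. F x * \<psi> x"])
    show "ereal a < ereal b" using ab by simp
  next
    fix x assume x: "ereal a < ereal x" "ereal x < ereal b"
    have "((\<lambda>x. F x * \<psi> x) has_real_derivative ?h x) (at x)"
      using x F[of x] \<psi>_der[of x] by (auto intro!: derivative_eq_intros)
    then show "((\<lambda>x. F x * \<psi> x) has_vector_derivative ?h x) (at x)"
      by (simp add: has_real_derivative_iff_has_vector_derivative)
    have "isCont F x"
      using x F[of x] DERIV_isCont by auto
    then show "isCont ?h x"
      using x f[of x] \<psi>_isCont by (intro continuous_intros) auto
  next
    show "set_integrable lborel (einterval (ereal a) (ereal b)) ?h"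
      using i1 i2 unfolding set_integrable_def by (simp add: ind del: real_scaleR_def)
  next
    show "(((\<lambda>x. F x * \<psi> x) \<circ> real_of_ereal) \<longlongrightarrow> A * \<psi> a) (at_right (ereal a))"
      unfolding ereal_tendsto_simps by (intro tendsto_mult A lims)
    show "(((\<lambda>x. F x * \<psi> x) \<circ> real_of_ereal) \<longlongrightarrow> B * \<psi> b) (at_left (ereal b))"
      unfolding ereal_tendsto_simps by (intro tendsto_mult B lims)
  qed
  moreover have "(LBINT x=ereal a..ereal b. ?h x) = (LINT x|lborel. ?h x)"
    using ab by (simp add: interval_lebesgue_integral_le_eq set_lebesgue_integral_def ind
        del: real_scaleR_def)
  moreover have "(LINT x|lborel. ?h x) = (LINT x|lborel. f x * \<psi> x) + (LINT x|lborel. F x * deriv \<psi> x)"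
    using i1 i2 by (rule Bochner_Integration.integral_add)
  ultimately show ?thesis by linarith
qed

text \<open>
  The density of \<open>(\<phi> \<phi>')'\<close> off the zeros of \<open>\<phi>\<close>: differentiating the first-order equation and
  dividing by \<open>\<phi>'\<close> gives \<open>\<phi> (\<phi> \<phi>')' = c \<phi> - \<phi>\<^sup>p\<^sup>-\<^sup>1\<close>.
\<close>

definition accel :: "real \<Rightarrow> real \<Rightarrow> (real \<Rightarrow> real) \<Rightarrow> real \<Rightarrow> real" where
  "accel p c \<phi> x = (if \<phi> x = 0 then 0 else c - \<bar>\<phi> x\<bar> powr (p - 2))"

lemma accel_measurable [measurable]:
  assumes [measurable]: "\<phi> \<in> borel_measurable borel"
  shows "accel p c \<phi> \<in> borel_measurable borel"
  unfolding accel_def by measurable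

lemma accel_bounded:
  assumes "p \<ge> 2" "\<bar>\<phi> x\<bar> \<le> K"
  shows "\<bar>accel p c \<phi> x\<bar> \<le> \<bar>c\<bar> + K powr (p - 2)"
proof (cases "\<phi> x = 0")
  case False
  have "\<bar>\<phi> x\<bar> powr (p - 2) \<le> K powr (p - 2)"
    using assms by (intro powr_mono2) auto
  moreover have "\<bar>\<phi> x\<bar> powr (p - 2) \<ge> 0" by simp
  moreover have "accel p c \<phi> x = c - \<bar>\<phi> x\<bar> powr (p - 2)"
    using False by (simp add: accel_def)
  ultimately show ?thesis by linarith
qed (simp add: accel_def)

lemma integrable_accel:
  assumes p: "p \<ge> 2" and \<phi>: "continuous_on UNIV \<phi>" and 0: "\<And>x. x \<notin> {a..b} \<Longrightarrow> \<phi> x = 0"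
  shows "integrable lborel (accel p c \<phi>)"
proof -
  have "bounded (\<phi> ` {a..b})"
    by (intro compact_imp_bounded compact_continuous_image continuous_on_subset[OF \<phi>]) auto
  then obtain K where K: "\<forall>x\<in>{a..b}. \<bar>\<phi> x\<bar> \<le> K"
    by (auto simp: bounded_iff)
  have [measurable]: "\<phi> \<in> borel_measurable borel"
    using \<phi> by (rule borel_measurable_continuous_onI)
  show ?thesis
  proof (rule integrableI_bounded_set[of "{a..b}"])
    show "AE x in lborel. x \<in> {a..b} \<longrightarrow> norm (accel p c \<phi> x) \<le> \<bar>c\<bar> + K powr (p - 2)"
      using accel_bounded[OF p] K by simp
    show "AE x in lborel. x \<notin> {a..b} \<longrightarrow> accel p c \<phi> x = 0"
      using 0 by (intro AE_I2) (auto simp: accel_def)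
  qed (auto simp: emeasure_lborel_Icc_eq)
qed

text \<open>
  The weak form of the profile equation for a positive bump on \<open>(-X, X)\<close>, where \<open>b\<close> is the jump of
  \<open>\<phi> \<phi>'\<close> at both end points.
\<close>

definition weak_bump :: "real \<Rightarrow> real \<Rightarrow> real \<Rightarrow> real \<Rightarrow> (real \<Rightarrow> real) \<Rightarrow> (real \<Rightarrow> real) \<Rightarrow> bool" where
  "weak_bump p c X b \<phi> v \<longleftrightarrow>
     X > 0 \<and> continuous_on UNIV \<phi> \<and>
     (\<forall>x. \<bar>x\<bar> < X \<longrightarrow> \<phi> x > 0) \<and> (\<forall>x. X \<le> \<bar>x\<bar> \<longrightarrow> \<phi> x = 0 \<and> v x = 0) \<and>
     integrable lborel v \<and>
     (\<forall>\<psi>. continuously_differentiable \<psi> \<longrightarrow>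
        (LINT x|lborel. \<phi> x * deriv \<psi> x) = - (LINT x|lborel. v x * \<psi> x)) \<and>
     (\<forall>\<psi>. continuously_differentiable \<psi> \<longrightarrow>
        (LINT x|lborel. \<phi> x * v x * deriv \<psi> x) =
          - b * (\<psi> X + \<psi> (- X)) - (LINT x|lborel. accel p c \<phi> x * \<psi> x))"

section \<open>Compactons\<close>

text \<open>The profile is the square root of the orbit \<open>w\<close>. Its derivative
  \<open>v\<close> may be unbounded at the ends, but \<open>\<Phi> v = u / 2\<close> is
  differentiable inside with one-sided limits there, so both weak identities are integrations by
  parts.\<close>

lemma compacton_profile:
  assumes p: "p \<ge> 2" and adm: "admissible p B c"
  obtains X \<Phi> b v where "weak_bump p c X b \<Phi> v"
    "smooth_on {-X<..<X} \<Phi>"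
    "\<And>x. \<Phi> (- x) = \<Phi> x"
    "strict_antimono_on {0<..<X} \<Phi>"
    "\<And>x. \<bar>x\<bar> < X \<Longrightarrow>
      - (c / 2) * (\<Phi> x)\<^sup>2 + 1 / 2 * (\<Phi> x * deriv \<Phi> x)\<^sup>2 + 1 / p * \<Phi> x powr p = B"
proof -
  define g where "g s = 4 * c - 4 * s powr (p / 2 - 1)" for s
  obtain M C where M: "M > 0" "C > 0" "energy p B c M = 0"
    "\<And>w. 0 < w \<Longrightarrow> w < M \<Longrightarrow> C * w * (M - w) \<le> energy p B c w"
    using energy_well[OF p adm] by blast
  have g: "(energy p B c has_real_derivative g s) (at s)" if "s > 0" for s
    using DERIV_energy[OF p that] by (simp add: g_def)
  obtain X w u where X: "X > 0"
    and w_pos: "\<And>x. \<bar>x\<bar> < X \<Longrightarrow> w x > 0"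
    and w_even: "\<And>x. \<bar>x\<bar> < X \<Longrightarrow> w (- x) = w x"
    and u_odd: "\<And>x. \<bar>x\<bar> < X \<Longrightarrow> u (- x) = - u x"
    and w_der: "\<And>x. \<bar>x\<bar> < X \<Longrightarrow> (w has_real_derivative u x) (at x)"
    and u_der: "\<And>x. \<bar>x\<bar> < X \<Longrightarrow> (u has_real_derivative g (w x) / 2) (at x)"
    and u_sq: "\<And>x. \<bar>x\<bar> < X \<Longrightarrow> (u x)\<^sup>2 = energy p B c (w x)"
    and u_neg: "\<And>x. 0 < x \<Longrightarrow> x < X \<Longrightarrow> u x < 0"
    and w_lim: "(w \<longlongrightarrow> 0) (at_left X)"
    and u_lim: "(u \<longlongrightarrow> - sqrt (energy p B c 0)) (at_left X)"
    using even_orbit_in_potential_well[where G = "energy p B c" and G' = g,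
        OF M g continuous_energy[OF p]] by blast
  define S where "S = {-X<..<X}"
  have S: "open S" "x \<in> S \<longleftrightarrow> \<bar>x\<bar> < X" for x
    by (auto simp: S_def)
  define \<Phi> where "\<Phi> x = (if x \<in> S then sqrt (w x) else 0)" for x
  define v where "v x = (if x \<in> S then u x / (2 * \<Phi> x) else 0)" for x
  \<comment> \<open>This equals sqrt(2 B), the limit of |\<Phi> \<Phi>'| at the end points.\<close>
  define b where "b = sqrt (energy p B c 0) / 2"
  have \<Phi>_pos: "\<Phi> x > 0" if "x \<in> S" for x
    using that w_pos S by (simp add: \<Phi>_def)
  have \<Phi>_sq: "(\<Phi> x)\<^sup>2 = w x" if "x \<in> S" for x
    using that w_pos[of x] S by (simp add: \<Phi>_def)
  have \<Phi>_powr: "\<Phi> x powr r = w x powr (r / 2)" if "x \<in> S" for x r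
    using w_pos[of x] that S by (simp add: \<Phi>_def powr_powr flip: powr_half_sqrt)
  have \<Phi>_even: "\<Phi> (- x) = \<Phi> x" for x
    using w_even[of x] by (simp add: \<Phi>_def S)
  have v_odd: "v (- x) = - v x" for x
    using u_odd[of x] by (simp add: v_def \<Phi>_even S)
  have \<Phi>_der: "(\<Phi> has_real_derivative v x) (at x)" if x: "x \<in> S" for x
  proof -
    have "((\<lambda>x. sqrt (w x)) has_real_derivative inverse (sqrt (w x)) / 2 * u x) (at x)"
      using x S w_pos w_der
      by (intro DERIV_chain2[where f = sqrt and g = w] DERIV_real_sqrt) auto
    then have "(\<Phi> has_real_derivative inverse (sqrt (w x)) / 2 * u x) (at x)"
      by (rule has_field_derivative_transform_within_open[OF _ S(1) x]) (simp add: \<Phi>_def)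
    then show ?thesis
      using x by (simp add: v_def \<Phi>_def field_simps)
  qed
  have \<Phi>_isCont_S: "isCont \<Phi> x" if "x \<in> S" for x
    using \<Phi>_der[OF that] by (rule DERIV_isCont)
  have u_isCont: "isCont u x" if "x \<in> S" for x
    using u_der[of x] that S by (intro DERIV_isCont) auto
  have v_isCont: "isCont v x" if x: "x \<in> S" for x
  proof -
    have "isCont (\<lambda>x. u x / (2 * \<Phi> x)) x"
      using \<Phi>_pos[OF x] u_isCont[OF x] \<Phi>_isCont_S[OF x] by (intro continuous_intros) auto
    moreover have "eventually (\<lambda>z. z \<in> S) (nhds x)"
      using S(1) x by (rule eventually_nhds_in_open)
    then have "eventually (\<lambda>z. v z = u z / (2 * \<Phi> z)) (nhds x)"
      by eventually_elim (simp add: v_def)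
    ultimately show ?thesis
      by (simp add: isCont_cong)
  qed
  have ev_S: "eventually (\<lambda>x. x \<in> S) (at_left X)"
    using X by (intro eventually_at_leftI[of 0]) (auto simp: S_def)
  have \<Phi>_left: "(\<Phi> \<longlongrightarrow> 0) (at_left X)"
  proof -
    have "((\<lambda>x. sqrt (w x)) \<longlongrightarrow> sqrt 0) (at_left X)"
      by (intro tendsto_intros w_lim)
    then have "((\<lambda>x. sqrt (w x)) \<longlongrightarrow> 0) (at_left X)"
      by simp
    then show ?thesis
      by (rule Lim_transform_eventually) (use ev_S in \<open>eventually_elim, simp add: \<Phi>_def\<close>)
  qed
  have \<Phi>_X: "isCont \<Phi> X"
  proof -
    have "(\<Phi> \<longlongrightarrow> 0) (at_right X)"
      by (rule Lim_transform_eventually[OF tendsto_const])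
         (use eventually_at_right_less[of X] in \<open>eventually_elim, auto simp: \<Phi>_def S\<close>)
    then show ?thesis
      using \<Phi>_left X by (simp add: isCont_def filterlim_at_split \<Phi>_def S)
  qed
  have minus: "isCont \<Phi> (- x)" if "isCont \<Phi> x" for x
  proof -
    have "isCont (\<lambda>y. \<Phi> (- y)) (- x)"
      by (rule isCont_o2[where f = uminus]) (use that in \<open>auto intro: continuous_intros\<close>)
    then show ?thesis by (simp add: \<Phi>_even)
  qed
  have \<Phi>_isCont: "isCont \<Phi> x" for x
  proof -
    consider "x \<in> S" | "x = X \<or> x = - X" | "X < \<bar>x\<bar>"
      using S(2)[of x] by linarith
    then show ?thesis
    proof cases
      case 1
      then show ?thesis by (rule \<Phi>_isCont_S)
    next
      case 2
      then show ?thesis using \<Phi>_X minus by blast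
    next
      case 3
      have "open {x::real. X < \<bar>x\<bar>}"
        by (intro open_Collect_less continuous_intros)
      then have "eventually (\<lambda>x. X < \<bar>x\<bar>) (nhds x)"
        using 3 by (intro eventually_nhds_in_open[of "{x. X < \<bar>x\<bar>}", simplified]) auto
      then have "eventually (\<lambda>x. \<Phi> x = 0) (nhds x)"
        by eventually_elim (simp add: \<Phi>_def S)
      then show ?thesis
        by (simp add: isCont_cong)
    qed
  qed
  then have \<Phi>_cont: "continuous_on UNIV \<Phi>"
    by (simp add: continuous_at_imp_continuous_on)
  have \<Phi>_0: "\<Phi> x = 0" "v x = 0" if "x \<notin> S" for x
    using that by (auto simp: \<Phi>_def v_def)
  have \<Phi>_int: "integrable lborel \<Phi>"
    by (rule integrable_continuous_on_interval[OF \<Phi>_cont, of "- X" X]) (auto simp: \<Phi>_0 S_def)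
  \<comment> \<open>No bound on \<open>v\<close> is at hand near the ends. On (0, X) it has constant
    sign and the primitive \<open>\<Phi>\<close> with finite limits, which suffices; oddness covers
    the left half.\<close>
  have v_int: "integrable lborel v"
  proof -
    have "set_integrable lborel (einterval (ereal 0) (ereal X)) (\<lambda>x. - v x)"
    proof (rule interval_integral_FTC_nonneg(1)[where F = "\<lambda>x. - \<Phi> x"])
      show "ereal 0 < ereal X" using X by simp
    next
      fix x assume "ereal 0 < ereal x" "ereal x < ereal X"
      then have x: "x \<in> S" by (simp add: S_def)
      show "((\<lambda>x. - \<Phi> x) has_real_derivative - v x) (at x)"
        by (intro DERIV_minus \<Phi>_der x)
      show "isCont (\<lambda>x. - v x) x"
        by (intro continuous_minus v_isCont x)
    next
      have "0 \<le> - v x" if "0 < x" "x < X" for x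
        using u_neg[OF that] that \<Phi>_pos[of x] by (simp add: v_def S_def divide_le_0_iff)
      then show "AE x in lborel. ereal 0 < ereal x \<longrightarrow> ereal x < ereal X \<longrightarrow> 0 \<le> - v x"
        by simp
    next
      have "isCont (\<lambda>x. - \<Phi> x) 0" using \<Phi>_isCont by (intro continuous_minus)
      then show "(((\<lambda>x. - \<Phi> x) \<circ> real_of_ereal) \<longlongrightarrow> - \<Phi> 0) (at_right (ereal 0))"
        unfolding ereal_tendsto_simps isCont_def filterlim_at_split by blast
      have "((\<lambda>x. - \<Phi> x) \<longlongrightarrow> - 0) (at_left X)"
        by (intro tendsto_minus \<Phi>_left)
      then show "(((\<lambda>x. - \<Phi> x) \<circ> real_of_ereal) \<longlongrightarrow> 0) (at_left (ereal X))"
        unfolding ereal_tendsto_simps by simp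
    qed
    then have half: "integrable lborel (\<lambda>x. indicator {0<..<X} x * - v x)"
      by (simp add: set_integrable_def)
    have "integrable lborel (\<lambda>x. indicator {0<..<X} (0 + (- 1) * x) * - v (0 + (- 1) * x))"
      by (rule lborel_integrable_real_affine[OF half]) simp
    then have "integrable lborel (\<lambda>x. indicator {0<..<X} (- x) * - v (- x) - indicator {0<..<X} x * - v x)"
      using half by (intro Bochner_Integration.integrable_diff) auto
    \<comment> \<open>The first term is the reflected half and equals \<open>v\<close> on the left
      by oddness; the second gives \<open>v\<close> on the right, and v(0) = 0.\<close>
    also have "(\<lambda>x. indicator {0<..<X} (- x) * - v (- x) - indicator {0<..<X} x * - v x) = v"
    proof
      fix x :: real
      have "v 0 = 0" using v_odd[of 0] by simp
      consider "0 < x" | "x < 0" | "x = 0" by linarith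
      then show "indicator {0<..<X} (- x) * - v (- x) - indicator {0<..<X} x * - v x = v x"
        by cases (auto simp: indicator_def v_odd \<open>v 0 = 0\<close> \<Phi>_0 S_def)
    qed
    finally show ?thesis .
  qed
  have \<Phi>v: "\<Phi> x * v x = u x / 2" if "x \<in> S" for x
    using \<Phi>_pos[OF that] that by (simp add: v_def)
  have \<Phi>v_int: "integrable lborel (\<lambda>x. \<Phi> x * v x)"
  proof -
    have "integrable lborel (\<lambda>x. v x * \<Phi> x)"
      by (rule integrable_mult_continuous[OF v_int \<Phi>_cont, of "- X" X]) (auto simp: \<Phi>_0 S_def)
    then show ?thesis by (simp add: mult.commute)
  qed
  \<comment> \<open>Half of u' = G'(w) / 2, and w^(p/2 - 1) is the power p - 2 of
    \<open>\<Phi>\<close>.\<close>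
  have accel: "accel p c \<Phi> x = g (w x) / 4" if "x \<in> S" for x
    using \<Phi>_pos[OF that] \<Phi>_powr[OF that, of "p - 2"]
    by (simp add: accel_def g_def diff_divide_distrib)
  have \<Phi>v_der: "((\<lambda>x. \<Phi> x * v x) has_real_derivative accel p c \<Phi> x) (at x)" if x: "x \<in> S" for x
  proof -
    have "((\<lambda>x. u x / 2) has_real_derivative accel p c \<Phi> x) (at x)"
      using DERIV_cdivide[OF u_der[of x], of 2] x by (simp add: accel S)
    then show ?thesis
      by (rule has_field_derivative_transform_within_open[OF _ S(1) x]) (simp add: \<Phi>v)
  qed
  have accel_isCont: "isCont (accel p c \<Phi>) x" if x: "x \<in> S" for x
  proof -
    have "isCont (\<lambda>x. c - \<Phi> x powr (p - 2)) x"
      using \<Phi>_pos[OF x] \<Phi>_isCont by (intro continuous_intros) auto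
    moreover have "eventually (\<lambda>z. z \<in> S) (nhds x)"
      using S(1) x by (rule eventually_nhds_in_open)
    then have "eventually (\<lambda>z. accel p c \<Phi> z = c - \<Phi> z powr (p - 2)) (nhds x)"
      by eventually_elim (use \<Phi>_pos in \<open>force simp: accel_def\<close>)
    ultimately show ?thesis
      by (simp add: isCont_cong)
  qed
  have \<Phi>v_left: "((\<lambda>x. \<Phi> x * v x) \<longlongrightarrow> - b) (at_left X)"
  proof -
    have "((\<lambda>x. u x / 2) \<longlongrightarrow> - sqrt (energy p B c 0) / 2) (at_left X)"
      by (intro tendsto_divide u_lim tendsto_const) simp
    then have "((\<lambda>x. u x / 2) \<longlongrightarrow> - b) (at_left X)"
      by (simp add: b_def)
    then show ?thesis
      by (rule Lim_transform_eventually) (use ev_S in \<open>eventually_elim, simp add: \<Phi>v\<close>)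
  qed
  \<comment> \<open>\<open>\<Phi> v\<close> is odd: it jumps from 0 to \<open>b\<close> at -X and
    from -b to 0 at X, so both masses have the same sign.\<close>
  have \<Phi>v_right: "((\<lambda>x. \<Phi> x * v x) \<longlongrightarrow> b) (at_right (- X))"
    using tendsto_minus[OF \<Phi>v_left] by (simp add: at_right_minus filterlim_filtermap \<Phi>_even v_odd)
  have \<Phi>_right: "(\<Phi> \<longlongrightarrow> 0) (at_right (- X))"
    using \<Phi>_left by (simp add: at_right_minus filterlim_filtermap \<Phi>_even)
  have weak1: "(LINT x|lborel. \<Phi> x * deriv \<psi> x) = - (LINT x|lborel. v x * \<psi> x)"
    if "continuously_differentiable \<psi>" for \<psi>
    using integral_by_parts_with_jumps[of "- X" X \<Phi> v, OF _ _ _ _ \<Phi>_int v_int \<Phi>_right \<Phi>_left that]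
      X \<Phi>_der v_isCont \<Phi>_0 by (simp add: S_def)
  have weak2: "(LINT x|lborel. \<Phi> x * v x * deriv \<psi> x) =
      - b * (\<psi> X + \<psi> (- X)) - (LINT x|lborel. accel p c \<Phi> x * \<psi> x)"
    if "continuously_differentiable \<psi>" for \<psi>
  proof -
    have "integrable lborel (accel p c \<Phi>)"
      using p \<Phi>_cont by (rule integrable_accel[of _ _ "- X" X]) (auto simp: \<Phi>_0 S_def)
    moreover have "accel p c \<Phi> x = 0" if "x \<notin> S" for x
      using \<Phi>_0(1)[OF that] by (simp add: accel_def)
    ultimately have "(LINT x|lborel. \<Phi> x * v x * deriv \<psi> x) =
        - b * \<psi> X - b * \<psi> (- X) - (LINT x|lborel. accel p c \<Phi> x * \<psi> x)"
      using X \<Phi>v_der accel_isCont \<Phi>_0 that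
      by (intro integral_by_parts_with_jumps \<Phi>v_int \<Phi>v_right \<Phi>v_left) (auto simp: S_def)
    then show ?thesis by (simp add: algebra_simps)
  qed
  have "weak_bump p c X b \<Phi> v"
    unfolding weak_bump_def using X \<Phi>_cont \<Phi>_pos \<Phi>_0 v_int weak1 weak2 by (auto simp: S)
  moreover have "smooth_on {-X<..<X} \<Phi>"
    unfolding S_def[symmetric]
  \<comment> \<open>The constants are those of u' = G'(w) / 2 = 2 c - 2 w^(p/2 - 1), expressed
    through \<open>\<Phi>\<close>.\<close>
  proof (rule smooth_on_derivation_closed[where u = u and k = "2 * c" and l = "- 2" and r = "p - 2"])
    fix x assume x: "x \<in> S"
    show "(\<Phi> has_real_derivative u x / (2 * \<Phi> x)) (at x)"
      using \<Phi>_der[OF x] x by (simp add: v_def)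
    show "(u has_real_derivative 2 * c + - 2 * \<Phi> x powr (p - 2)) (at x)"
      using u_der[of x] x \<Phi>_powr[OF x, of "p - 2"] by (simp add: S g_def diff_divide_distrib)
  qed (use S \<Phi>_pos in auto)
  moreover have "strict_antimono_on {0<..<X} \<Phi>"
  proof (rule monotone_onI)
    fix x y assume xy: "x \<in> {0<..<X}" "y \<in> {0<..<X}" "x < y"
    show "\<Phi> x > \<Phi> y"
    proof (rule DERIV_neg_imp_decreasing[OF xy(3)])
      fix z assume z: "x \<le> z" "z \<le> y"
      then have "z \<in> S" "v z < 0"
        using xy u_neg[of z] \<Phi>_pos[of z] by (auto simp: S_def v_def divide_neg_pos)
      then show "\<exists>D. (\<Phi> has_real_derivative D) (at z) \<and> D < 0"
        using \<Phi>_der by blast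
    qed
  qed
  moreover have "- (c / 2) * (\<Phi> x)\<^sup>2 + 1 / 2 * (\<Phi> x * deriv \<Phi> x)\<^sup>2 + 1 / p * \<Phi> x powr p = B"
    if "\<bar>x\<bar> < X" for x
  proof -
    have x: "x \<in> S" using that by (simp add: S)
    have "\<Phi> x * deriv \<Phi> x = u x / 2"
      using DERIV_imp_deriv[OF \<Phi>_der[OF x]] \<Phi>v[OF x] by simp
    then have "(\<Phi> x * deriv \<Phi> x)\<^sup>2 = (u x / 2)\<^sup>2"
      by (rule arg_cong)
    also have "\<dots> = energy p B c (w x) / 4"
      by (simp add: power_divide u_sq[OF that])
    finally have "(\<Phi> x * deriv \<Phi> x)\<^sup>2 = energy p B c (w x) / 4" .
    then show ?thesis
      unfolding \<Phi>_sq[OF x] \<Phi>_powr[OF x] by (simp add: energy_def)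
  qed
  ultimately show ?thesis
    using that \<Phi>_even by blast
qed

section \<open>Superposition\<close>

lemma weak_bumpD:
  assumes "weak_bump p c X b \<Phi> v"
  shows "X > 0" "continuous_on UNIV \<Phi>" "\<And>x. \<bar>x\<bar> < X \<Longrightarrow> \<Phi> x > 0"
    "\<And>x. X \<le> \<bar>x\<bar> \<Longrightarrow> \<Phi> x = 0" "\<And>x. X \<le> \<bar>x\<bar> \<Longrightarrow> v x = 0" "integrable lborel v"
    "\<And>\<psi>. continuously_differentiable \<psi> \<Longrightarrow>
        (LINT x|lborel. \<Phi> x * deriv \<psi> x) = - (LINT x|lborel. v x * \<psi> x)"
    "\<And>\<psi>. continuously_differentiable \<psi> \<Longrightarrow>
        (LINT x|lborel. \<Phi> x * v x * deriv \<psi> x) =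
          - b * (\<psi> X + \<psi> (- X)) - (LINT x|lborel. accel p c \<Phi> x * \<psi> x)"
  using assms by (simp_all add: weak_bump_def)

section \<open>Translated bumps\<close>

lemma lborel_integral_translate:
  fixes f :: "real \<Rightarrow> real"
  shows "(LINT x|lborel. f (x - \<xi>) * h x) = (LINT x|lborel. f x * h (\<xi> + x))"
  using lborel_integral_real_affine[of 1 "\<lambda>x. f (x - \<xi>) * h x" \<xi>] by simp

lemma integrable_translate:
  fixes f :: "real \<Rightarrow> real"
  assumes "integrable lborel f"
  shows "integrable lborel (\<lambda>x. f (x - \<xi>))"
  using lborel_integrable_real_affine[OF assms, of 1 "- \<xi>"] by simp

lemma accel_translate: "accel p c (\<lambda>x. \<phi> (x - \<xi>)) = (\<lambda>x. accel p c \<phi> (x - \<xi>))"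
  by (auto simp: accel_def)

text \<open>A change of variable moves the shift onto the test function, where the centred
  identities apply.\<close>

lemma weak_bump_translate:
  assumes bump: "weak_bump p c X b \<Phi> v" and \<psi>: "continuously_differentiable \<psi>"
  shows "(LINT x|lborel. \<Phi> (x - \<xi>) * deriv \<psi> x) = - (LINT x|lborel. v (x - \<xi>) * \<psi> x)"
    and "(LINT x|lborel. \<Phi> (x - \<xi>) * v (x - \<xi>) * deriv \<psi> x) =
      - b * (\<psi> (\<xi> + X) + \<psi> (\<xi> - X)) - (LINT x|lborel. accel p c \<Phi> (x - \<xi>) * \<psi> x)"
  using weak_bumpD(7,8)[OF bump continuously_differentiable_translate(1)[OF \<psi>, of \<xi>]]
    lborel_integral_translate[of "\<lambda>x. \<Phi> x * v x"]
  by (simp_all add: lborel_integral_translate continuously_differentiable_translate(2)[OF \<psi>])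

lemma supp_weak_bump_translate:
  assumes "weak_bump p c X b \<Phi> v"
  shows "supp (\<lambda>x. \<Phi> (x - \<xi>)) = {\<xi> - X..\<xi> + X}"
proof -
  have "\<Phi> (x - \<xi>) \<noteq> 0 \<longleftrightarrow> \<bar>x - \<xi>\<bar> < X" for x
    using weak_bumpD(3,4)[OF assms, of "x - \<xi>"] by (metis less_irrefl not_less)
  then have "{x. \<Phi> (x - \<xi>) \<noteq> 0} = {x. \<bar>x - \<xi>\<bar> < X}"
    by simp
  also have "\<dots> = {\<xi> - X<..<\<xi> + X}"
    by (auto simp: abs_less_iff)
  finally have "{x. \<Phi> (x - \<xi>) \<noteq> 0} = {\<xi> - X<..<\<xi> + X}" .
  then show ?thesis
    using weak_bumpD(1)[OF assms] by (simp add: supp_def)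
qed

section \<open>Locally finite sums tested against compact support\<close>

lemma deriv_eq_0_outside_supp:
  assumes "x \<notin> supp \<psi>"
  shows "\<psi> x = 0" "deriv \<psi> x = 0"
proof -
  have out: "\<psi> y = 0" if "y \<in> - supp \<psi>" for y
    using that closure_subset[of "{x. \<psi> x \<noteq> 0}"] by (auto simp: supp_def)
  then show "\<psi> x = 0" using assms by simp
  have "((\<lambda>x. 0) has_real_derivative 0) (at x)" by simp
  then have "(\<psi> has_real_derivative 0) (at x)"
  proof (rule has_field_derivative_transform_within_open)
    show "open (- supp \<psi>)" by (simp add: supp_def open_Compl)
    show "x \<in> - supp \<psi>" using assms by simp
    show "0 = \<psi> y" if "y \<in> - supp \<psi>" for y using out[OF that] by simp
  qed
  then show "deriv \<psi> x = 0" by (rule DERIV_imp_deriv)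
qed

text \<open>Over a set \<open>K\<close> meeting finitely many of the sets \<open>A i\<close>, the
  possibly infinite sum is one finite sum with the same index set for all points of
  \<open>K\<close>.\<close>

lemma locally_finite_infsum:
  fixes F :: "nat \<Rightarrow> real \<Rightarrow> real"
  assumes J: "finite {i \<in> I. A i \<inter> K \<noteq> {}}" and x: "x \<in> K"
    and 0: "\<And>i. i \<in> I \<Longrightarrow> x \<notin> A i \<Longrightarrow> F i x = 0"
  shows "(\<Sum>\<^sub>\<infinity>i\<in>I. F i x) = (\<Sum>i\<in>{i \<in> I. A i \<inter> K \<noteq> {}}. F i x)"
proof -
  have "(\<Sum>\<^sub>\<infinity>i\<in>I. F i x) = (\<Sum>\<^sub>\<infinity>i\<in>{i \<in> I. A i \<inter> K \<noteq> {}}. F i x)"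
    by (intro infsum_cong_neutral) (use 0 x in auto)
  then show ?thesis
    using J by simp
qed

lemma integral_locally_finite_infsum:
  fixes F :: "nat \<Rightarrow> real \<Rightarrow> real"
  assumes J: "finite {i \<in> I. A i \<inter> K \<noteq> {}}"
    and 0: "\<And>i x. i \<in> I \<Longrightarrow> x \<notin> A i \<Longrightarrow> F i x = 0"
    and \<eta>: "\<And>x. x \<notin> K \<Longrightarrow> \<eta> x = 0"
    and int: "\<And>i. i \<in> I \<Longrightarrow> integrable lborel (\<lambda>x. F i x * \<eta> x)"
  shows "integrable lborel (\<lambda>x. (\<Sum>\<^sub>\<infinity>i\<in>I. F i x) * \<eta> x)"
    and "(LINT x|lborel. (\<Sum>\<^sub>\<infinity>i\<in>I. F i x) * \<eta> x) =
      (\<Sum>i\<in>{i \<in> I. A i \<inter> K \<noteq> {}}. LINT x|lborel. F i x * \<eta> x)"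
proof -
  have eq: "(\<lambda>x. (\<Sum>\<^sub>\<infinity>i\<in>I. F i x) * \<eta> x) = (\<lambda>x. \<Sum>i\<in>{i \<in> I. A i \<inter> K \<noteq> {}}. F i x * \<eta> x)"
  proof
    show "(\<Sum>\<^sub>\<infinity>i\<in>I. F i x) * \<eta> x = (\<Sum>i\<in>{i \<in> I. A i \<inter> K \<noteq> {}}. F i x * \<eta> x)" for x
    proof (cases "x \<in> K")
      case True
      then show ?thesis
        using locally_finite_infsum[where F = F, OF J True] 0 by (simp add: sum_distrib_right)
    qed (simp add: \<eta>)
  qed
  show "integrable lborel (\<lambda>x. (\<Sum>\<^sub>\<infinity>i\<in>I. F i x) * \<eta> x)"
    "(LINT x|lborel. (\<Sum>\<^sub>\<infinity>i\<in>I. F i x) * \<eta> x) =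
      (\<Sum>i\<in>{i \<in> I. A i \<inter> K \<noteq> {}}. LINT x|lborel. F i x * \<eta> x)"
    unfolding eq using int by (auto intro!: Bochner_Integration.integral_sum)
qed

text \<open>The derivative of the sum is handled by linearity. The nonlinear quantities \<phi>
  \<phi>' and \<open>accel\<close> are also sums over the bumps, since no point is interior to two
  of them, and the signs disappear as \<epsilon>^2 = 1. With this density the equation itself holds
  pointwise under the integral.\<close>

lemma solves_profile_eq_superposition:
  fixes \<Phi> v :: "nat \<Rightarrow> real \<Rightarrow> real" and \<epsilon> X b \<xi> :: "nat \<Rightarrow> real"
  assumes p: "p \<ge> 2"
    and bump: "\<And>i. i \<in> I \<Longrightarrow> weak_bump p c (X i) (b i) (\<Phi> i) (v i)"
    and sign: "\<And>i. i \<in> I \<Longrightarrow> \<epsilon> i \<in> {1, -1}"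
    and lf: "locally_finite_family I (\<lambda>i x. \<Phi> i (x - \<xi> i))"
    and no: "non_overlapping I (\<lambda>i x. \<Phi> i (x - \<xi> i))"
  shows "solves_profile_eq p c (\<lambda>x. \<Sum>\<^sub>\<infinity>i\<in>I. \<epsilon> i * \<Phi> i (x - \<xi> i))"
proof -
  define A where "A i = {\<xi> i - X i..\<xi> i + X i}" for i
  define J where "J K = {i \<in> I. A i \<inter> K \<noteq> {}}" for K
  define \<phi> where "\<phi> x = (\<Sum>\<^sub>\<infinity>i\<in>I. \<epsilon> i * \<Phi> i (x - \<xi> i))" for x
  define w where "w x = (\<Sum>\<^sub>\<infinity>i\<in>I. \<epsilon> i * v i (x - \<xi> i))" for x
  define S where "S = (\<Union>i\<in>I. {\<xi> i - X i, \<xi> i + X i})"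
  \<comment> \<open>The two masses of one bump as a function on the line; summing over
    \<open>i\<close> adds the masses of bumps that share an end point.\<close>
  define m where "m i y = b i * (of_bool (y = \<xi> i + X i) + of_bool (y = \<xi> i - X i))" for i y
  define a where "a y = (\<Sum>\<^sub>\<infinity>i\<in>I. m i y)" for y
  define g where "g = accel p c \<phi>"
  have X: "X i > 0" if "i \<in> I" for i
    using bump[OF that] by (rule weak_bumpD)
  have supp: "supp (\<lambda>x. \<Phi> i (x - \<xi> i)) = A i" if "i \<in> I" for i
    using supp_weak_bump_translate[OF bump[OF that]] by (simp add: A_def)
  have finJ: "finite (J K)" if "compact K" for K
  proof -
    have "J K = {i \<in> I. supp (\<lambda>x. \<Phi> i (x - \<xi> i)) \<inter> K \<noteq> {}}"
      unfolding J_def using supp by (intro Collect_cong conj_cong) auto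
    then show ?thesis
      using lf that by (simp add: locally_finite_family_def)
  qed
  have disj: "i = j" if "i \<in> I" "j \<in> I" "\<bar>x - \<xi> i\<bar> < X i" "\<bar>x - \<xi> j\<bar> < X j" for i j x
  proof (rule ccontr)
    assume "i \<noteq> j"
    then have "interior (A i) \<inter> interior (A j) = {}"
      using no that(1,2) supp by (auto simp: non_overlapping_def disjoint_family_on_def)
    moreover have "x \<in> interior (A i) \<inter> interior (A j)"
      using that by (auto simp: A_def abs_less_iff)
    ultimately show False by blast
  qed
  have in_A: "x \<in> A i \<longleftrightarrow> \<bar>x - \<xi> i\<bar> \<le> X i" for x i
    by (auto simp: A_def abs_le_iff)
  have \<Phi>_0: "\<Phi> i (x - \<xi> i) = 0" "v i (x - \<xi> i) = 0" "accel p c (\<Phi> i) (x - \<xi> i) = 0"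
    if "i \<in> I" "X i \<le> \<bar>x - \<xi> i\<bar>" for i x
    using weak_bumpD(4,5)[OF bump[OF that(1)] that(2)] by (auto simp: accel_def)
  have \<Phi>_A: "\<Phi> i (x - \<xi> i) = 0" "v i (x - \<xi> i) = 0" "accel p c (\<Phi> i) (x - \<xi> i) = 0"
    if "i \<in> I" "x \<notin> A i" for i x
    using \<Phi>_0[OF that(1), of x] that(2) by (auto simp: in_A)
  have single: "(\<Sum>\<^sub>\<infinity>i\<in>I. F i) = F k"
    if "k \<in> I" "\<bar>x - \<xi> k\<bar> < X k" and F: "\<And>i. i \<in> I \<Longrightarrow> X i \<le> \<bar>x - \<xi> i\<bar> \<Longrightarrow> F i = 0"
    for F :: "nat \<Rightarrow> real" and k x
  proof -
    have "(\<Sum>\<^sub>\<infinity>i\<in>I. F i) = (\<Sum>\<^sub>\<infinity>i\<in>{k}. F i)"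
    proof (rule infsum_cong_neutral)
      fix i assume "i \<in> I - {k}"
      then have "\<not> \<bar>x - \<xi> i\<bar> < X i"
        using disj[of i k x] that(1,2) by blast
      then show "F i = 0" using F \<open>i \<in> I - {k}\<close> by simp
    qed (use that(1) in auto)
    then show ?thesis by simp
  qed
  have none: "(\<Sum>\<^sub>\<infinity>i\<in>I. F i) = 0"
    if "\<And>i. i \<in> I \<Longrightarrow> X i \<le> \<bar>x - \<xi> i\<bar>" and F: "\<And>i. i \<in> I \<Longrightarrow> X i \<le> \<bar>x - \<xi> i\<bar> \<Longrightarrow> F i = 0"
    for F :: "nat \<Rightarrow> real" and x
    using that by (intro infsum_0) auto
  have \<phi>w: "\<phi> x * w x = (\<Sum>\<^sub>\<infinity>i\<in>I. \<Phi> i (x - \<xi> i) * v i (x - \<xi> i))"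
    and g_eq: "g x = (\<Sum>\<^sub>\<infinity>i\<in>I. accel p c (\<Phi> i) (x - \<xi> i))" for x
  proof -
    have "\<phi> x * w x = (\<Sum>\<^sub>\<infinity>i\<in>I. \<Phi> i (x - \<xi> i) * v i (x - \<xi> i)) \<and>
        g x = (\<Sum>\<^sub>\<infinity>i\<in>I. accel p c (\<Phi> i) (x - \<xi> i))"
    proof (cases "\<exists>k\<in>I. \<bar>x - \<xi> k\<bar> < X k")
      case True
      then obtain k where k: "k \<in> I" "\<bar>x - \<xi> k\<bar> < X k" by blast
      have "\<phi> x = \<epsilon> k * \<Phi> k (x - \<xi> k)" "w x = \<epsilon> k * v k (x - \<xi> k)"
        "(\<Sum>\<^sub>\<infinity>i\<in>I. \<Phi> i (x - \<xi> i) * v i (x - \<xi> i)) = \<Phi> k (x - \<xi> k) * v k (x - \<xi> k)"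
        "(\<Sum>\<^sub>\<infinity>i\<in>I. accel p c (\<Phi> i) (x - \<xi> i)) = accel p c (\<Phi> k) (x - \<xi> k)"
        unfolding \<phi>_def w_def by (rule single[OF k]; simp add: \<Phi>_0)+
      then show ?thesis
        using sign[OF k(1)] by (auto simp: g_def accel_def)
    next
      case False
      then have out: "X i \<le> \<bar>x - \<xi> i\<bar>" if "i \<in> I" for i
        using that by force
      have "\<phi> x = 0" "(\<Sum>\<^sub>\<infinity>i\<in>I. \<Phi> i (x - \<xi> i) * v i (x - \<xi> i)) = 0"
        "(\<Sum>\<^sub>\<infinity>i\<in>I. accel p c (\<Phi> i) (x - \<xi> i)) = 0"
        unfolding \<phi>_def by (rule none[OF out]; simp add: \<Phi>_0)+
      then show ?thesis
        by (simp add: g_def accel_def)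
    qed
    then show "\<phi> x * w x = (\<Sum>\<^sub>\<infinity>i\<in>I. \<Phi> i (x - \<xi> i) * v i (x - \<xi> i))"
      "g x = (\<Sum>\<^sub>\<infinity>i\<in>I. accel p c (\<Phi> i) (x - \<xi> i))" by auto
  qed
  have \<phi>_S: "\<phi> y = 0" if "y \<in> S" for y
  proof -
    obtain k where k: "k \<in> I" "y = \<xi> k - X k \<or> y = \<xi> k + X k"
      using \<open>y \<in> S\<close> by (auto simp: S_def)
    have "X i \<le> \<bar>y - \<xi> i\<bar>" if i: "i \<in> I" for i
    proof (rule ccontr)
      assume y: "\<not> X i \<le> \<bar>y - \<xi> i\<bar>"
      \<comment> \<open>If an end point \<open>y\<close> of bump \<open>k\<close> were interior to
        bump \<open>i\<close>, a step \<open>t\<close> towards the centre of \<open>k\<close> would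
        give a point \<open>z\<close> interior to both. Then i = k, but an end point of
        \<open>k\<close> is not interior to \<open>k\<close>.\<close>
      define t where "t = min (X i - \<bar>y - \<xi> i\<bar>) (X k) / 2"
      define z where "z = (if y = \<xi> k - X k then y + t else y - t)"
      have t: "0 < t" "t < X i - \<bar>y - \<xi> i\<bar>" "t < X k"
        using y X[OF k(1)] by (auto simp: t_def min_def)
      then have "\<bar>z - \<xi> i\<bar> < X i" "\<bar>z - \<xi> k\<bar> < X k"
        using k(2) by (auto simp: z_def abs_if split: if_splits)
      then have "i = k"
        using disj i k(1) by blast
      then show False
        using y k X[OF k(1)] by auto
    qed
    then show ?thesis
      unfolding \<phi>_def by (rule none[where x = y]) (simp_all add: \<Phi>_0)
  qed

  have \<Phi>_cont: "continuous_on UNIV (\<lambda>x. \<Phi> i (x - \<xi> i))" if "i \<in> I" for i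
    by (rule continuous_on_compose2[OF weak_bumpD(2)[OF bump[OF that]]]) (auto intro: continuous_intros)
  have \<phi>_cont: "continuous_on UNIV \<phi>"
  proof (rule continuous_at_imp_continuous_on, rule ballI)
    fix x
    \<comment> \<open>Continuity is local, and near \<open>x\<close> only finitely many bumps
      contribute.\<close>
    have fin: "finite (J (cball x 1))"
      by (intro finJ compact_cball)
    have "continuous_on UNIV (\<lambda>x. \<Sum>i\<in>J (cball x0 1). \<epsilon> i * \<Phi> i (x - \<xi> i))" for x0
      by (intro continuous_intros \<Phi>_cont) (simp add: J_def)
    then have "isCont (\<lambda>y. \<Sum>i\<in>J (cball x 1). \<epsilon> i * \<Phi> i (y - \<xi> i)) x"
      by (simp add: continuous_on_eq_continuous_at)
    moreover have "eventually (\<lambda>y. y \<in> ball x 1) (nhds x)"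
      by (intro eventually_nhds_in_open) auto
    then have "eventually (\<lambda>y. \<phi> y = (\<Sum>i\<in>J (cball x 1). \<epsilon> i * \<Phi> i (y - \<xi> i))) (nhds x)"
    proof eventually_elim
      case (elim y)
      then have "y \<in> cball x 1" by simp
      then show ?case
        unfolding \<phi>_def J_def
        by (rule locally_finite_infsum[OF fin[unfolded J_def]]) (simp add: \<Phi>_A)
    qed
    ultimately show "isCont \<phi> x"
      by (simp add: isCont_cong)
  qed
  then have [measurable]: "\<phi> \<in> borel_measurable borel"
    by (rule borel_measurable_continuous_onI)
  have \<phi>_bdd: "\<exists>M. \<forall>x\<in>K. \<bar>\<phi> x\<bar> \<le> M" if "compact K" for K
  proof -
    have "bounded (\<phi> ` K)"
      by (intro compact_imp_bounded compact_continuous_image continuous_on_subset[OF \<phi>_cont] that) auto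
    then show ?thesis by (auto simp: bounded_iff)
  qed
  have v_int: "integrable lborel (\<lambda>x. v i (x - \<xi> i))" if "i \<in> I" for i
    using weak_bumpD(6)[OF bump[OF that]] by (rule integrable_translate)
  have \<Phi>_int: "integrable lborel (\<lambda>x. \<Phi> i (x - \<xi> i))" if "i \<in> I" for i
    using \<Phi>_cont[OF that]
    by (rule integrable_continuous_on_interval[of _ "\<xi> i - X i" "\<xi> i + X i"])
       (use \<Phi>_A(1)[OF that] in \<open>auto simp: A_def\<close>)
  have accel_int: "integrable lborel (\<lambda>x. accel p c (\<Phi> i) (x - \<xi> i))" if "i \<in> I" for i
    using integrable_accel[OF p \<Phi>_cont[OF that], of "\<xi> i - X i" "\<xi> i + X i"] \<Phi>_A(1)[OF that]
    by (simp add: accel_translate A_def)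
  have mult_int: "integrable lborel (\<lambda>x. f x * \<eta> x)"
    if "i \<in> I" "integrable lborel f" "\<And>x. x \<notin> A i \<Longrightarrow> f x = 0" "continuous_on UNIV \<eta>"
    for i and f \<eta> :: "real \<Rightarrow> real"
    using that(2,4) by (rule integrable_mult_continuous[of _ _ "\<xi> i - X i" "\<xi> i + X i"])
       (use that(3) in \<open>auto simp: A_def\<close>)
  have \<Phi>v_int: "integrable lborel (\<lambda>x. \<Phi> i (x - \<xi> i) * v i (x - \<xi> i))" if "i \<in> I" for i
    using mult_int[OF that v_int[OF that] \<Phi>_A(2)[OF that] \<Phi>_cont[OF that]] by (simp add: mult.commute)

  have w_loc: "locally_integrable w"
    unfolding locally_integrable_def
  proof (intro allI impI)
    fix K :: "real set" assume K: "compact K"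
    have "integrable lborel (\<lambda>x. w x * indicator K x)"
      unfolding w_def
    \<comment> \<open>The cutoff is the indicator of \<open>K\<close>, which is not continuous in
      general; that lemma asks for integrability of each product instead.\<close>
    proof (rule integral_locally_finite_infsum(1)[where A = A and K = K])
      show "integrable lborel (\<lambda>x. \<epsilon> i * v i (x - \<xi> i) * indicator K x)" if "i \<in> I" for i
        using v_int[OF that] compact_imp_closed[OF K]
        by (intro integrable_real_mult_indicator) auto
    qed (use finJ[OF K] \<Phi>_A(2) in \<open>auto simp: J_def\<close>)
    then show "set_integrable lborel K w"
      by (simp add: set_integrable_def mult.commute)
  qed
  have g_meas: "g \<in> borel_measurable borel"
    unfolding g_def by measurable
  have g_bdd: "locally_bounded g"
    unfolding locally_bounded_def
  proof (intro allI impI)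
    fix K :: "real set" assume "compact K"
    then obtain M where "\<forall>x\<in>K. \<bar>\<phi> x\<bar> \<le> M" using \<phi>_bdd by blast
    then have "\<forall>x\<in>K. \<bar>g x\<bar> \<le> \<bar>c\<bar> + M powr (p - 2)"
      unfolding g_def using accel_bounded[OF p] by blast
    then show "bounded (g ` K)" by (auto simp: bounded_iff)
  qed
  have S_fin: "finite (S \<inter> K)" if K: "compact K" for K
  proof (rule finite_subset)
    show "S \<inter> K \<subseteq> (\<Union>i\<in>J K. {\<xi> i - X i, \<xi> i + X i})"
    proof
      fix y assume y: "y \<in> S \<inter> K"
      then obtain i where i: "i \<in> I" "y \<in> {\<xi> i - X i, \<xi> i + X i}" by (auto simp: S_def)
      then have "y \<in> A i" using X[OF i(1)] by (auto simp: A_def)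
      then show "y \<in> (\<Union>i\<in>J K. {\<xi> i - X i, \<xi> i + X i})"
        using i y by (auto simp: J_def)
    qed
  qed (use finJ[OF K] in auto)

  have compact_supp: "compact (supp \<psi>)" and C1: "continuously_differentiable \<psi>"
    and cont: "continuous_on UNIV \<psi>" "continuous_on UNIV (deriv \<psi>)" if "test_function \<psi>" for \<psi>
    using that continuously_differentiable_test_function[OF that]
      continuously_differentiable_imp_continuous[of \<psi>]
    by (auto simp: test_function_def continuously_differentiable_def)

  have family_integral: "integrable lborel (\<lambda>x. (\<Sum>\<^sub>\<infinity>i\<in>I. F i x) * \<eta> x)"
      "(LINT x|lborel. (\<Sum>\<^sub>\<infinity>i\<in>I. F i x) * \<eta> x) = (\<Sum>i\<in>J K. LINT x|lborel. F i x * \<eta> x)"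
    if "compact K" "continuous_on UNIV \<eta>" "\<And>x. x \<notin> K \<Longrightarrow> \<eta> x = 0"
      "\<And>i. i \<in> I \<Longrightarrow> integrable lborel (F i)" "\<And>i x. i \<in> I \<Longrightarrow> x \<notin> A i \<Longrightarrow> F i x = 0"
    for F :: "nat \<Rightarrow> real \<Rightarrow> real" and \<eta> :: "real \<Rightarrow> real" and K
  proof -
    have "integrable lborel (\<lambda>x. F i x * \<eta> x)" if "i \<in> I" for i
      using that \<open>\<And>i. i \<in> I \<Longrightarrow> integrable lborel (F i)\<close>[OF that]
        \<open>\<And>i x. i \<in> I \<Longrightarrow> x \<notin> A i \<Longrightarrow> F i x = 0\<close>[OF that] \<open>continuous_on UNIV \<eta>\<close>
      by (rule mult_int)
    note int = this
    have fin: "finite {i \<in> I. A i \<inter> K \<noteq> {}}"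
      using finJ[OF that(1)] by (simp add: J_def)
    show "integrable lborel (\<lambda>x. (\<Sum>\<^sub>\<infinity>i\<in>I. F i x) * \<eta> x)"
      by (rule integral_locally_finite_infsum(1)[OF fin]) (use that(3,5) int in auto)
    show "(LINT x|lborel. (\<Sum>\<^sub>\<infinity>i\<in>I. F i x) * \<eta> x) = (\<Sum>i\<in>J K. LINT x|lborel. F i x * \<eta> x)"
      unfolding J_def by (rule integral_locally_finite_infsum(2)[OF fin]) (use that(3,5) int in auto)
  qed
  have \<phi>_integral: "integrable lborel (\<lambda>x. \<phi> x * deriv \<psi> x)"
      "(LINT x|lborel. \<phi> x * deriv \<psi> x) = (\<Sum>i\<in>J (supp \<psi>). LINT x|lborel. \<epsilon> i * \<Phi> i (x - \<xi> i) * deriv \<psi> x)"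
    if \<psi>: "test_function \<psi>" for \<psi>
  proof -
    show "integrable lborel (\<lambda>x. \<phi> x * deriv \<psi> x)"
      unfolding \<phi>_def
      by (rule family_integral(1)[OF compact_supp[OF \<psi>] cont(2)[OF \<psi>]])
         (simp_all add: deriv_eq_0_outside_supp \<Phi>_int \<Phi>_A)
    show "(LINT x|lborel. \<phi> x * deriv \<psi> x) =
        (\<Sum>i\<in>J (supp \<psi>). LINT x|lborel. \<epsilon> i * \<Phi> i (x - \<xi> i) * deriv \<psi> x)"
      unfolding \<phi>_def
      by (rule family_integral(2)[OF compact_supp[OF \<psi>] cont(2)[OF \<psi>]])
         (simp_all add: deriv_eq_0_outside_supp \<Phi>_int \<Phi>_A)
  qed
  have eq1: "dist_eq (dist_deriv (dist_fun \<phi>)) (dist_fun w)"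
    unfolding dist_eq_def dist_deriv_def dist_fun_def
  proof (intro allI impI)
    fix \<psi> assume \<psi>: "test_function \<psi>"
    have "(LINT x|lborel. w x * \<psi> x) = (\<Sum>i\<in>J (supp \<psi>). LINT x|lborel. \<epsilon> i * v i (x - \<xi> i) * \<psi> x)"
      unfolding w_def
      by (rule family_integral(2)[OF compact_supp[OF \<psi>] cont(1)[OF \<psi>]])
         (simp_all add: deriv_eq_0_outside_supp v_int \<Phi>_A)
    also have "\<dots> = (\<Sum>i\<in>J (supp \<psi>). - (LINT x|lborel. \<epsilon> i * \<Phi> i (x - \<xi> i) * deriv \<psi> x))"
    proof (rule sum.cong)
      fix i assume "i \<in> J (supp \<psi>)"
      then have "i \<in> I" by (simp add: J_def)
      from weak_bump_translate(1)[OF bump[OF this] C1[OF \<psi>]]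
      show "(LINT x|lborel. \<epsilon> i * v i (x - \<xi> i) * \<psi> x) =
          - (LINT x|lborel. \<epsilon> i * \<Phi> i (x - \<xi> i) * deriv \<psi> x)"
        by (simp add: mult.assoc)
    qed simp
    also have "\<dots> = - (LINT x|lborel. \<phi> x * deriv \<psi> x)"
      by (simp add: \<phi>_integral[OF \<psi>] sum_negf)
    finally show "- (LINT x|lborel. \<phi> x * deriv \<psi> x) = (LINT x|lborel. w x * \<psi> x)" by simp
  qed
  have eq2: "dist_eq (dist_deriv (dist_fun (\<lambda>x. \<phi> x * w x))) (dist_meas g S a)"
    unfolding dist_eq_def dist_deriv_def dist_meas_def
  proof (intro allI impI)
    fix \<psi> assume \<psi>: "test_function \<psi>"
    define K where "K = supp \<psi>"
    have K: "compact K" by (simp add: K_def compact_supp \<psi>)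
    have "(LINT x|lborel. \<phi> x * w x * deriv \<psi> x) =
        (\<Sum>i\<in>J K. LINT x|lborel. \<Phi> i (x - \<xi> i) * v i (x - \<xi> i) * deriv \<psi> x)"
      unfolding \<phi>w K_def
      by (rule family_integral(2)[OF compact_supp[OF \<psi>] cont(2)[OF \<psi>]])
         (simp_all add: deriv_eq_0_outside_supp \<Phi>v_int \<Phi>_A)
    also have "\<dots> = (\<Sum>i\<in>J K. - (b i * (\<psi> (\<xi> i + X i) + \<psi> (\<xi> i - X i))
        + (LINT x|lborel. accel p c (\<Phi> i) (x - \<xi> i) * \<psi> x)))"
    proof (rule sum.cong)
      fix i assume "i \<in> J K"
      then have "i \<in> I" by (simp add: J_def)
      from weak_bump_translate(2)[OF bump[OF this] C1[OF \<psi>]]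
      show "(LINT x|lborel. \<Phi> i (x - \<xi> i) * v i (x - \<xi> i) * deriv \<psi> x) =
        - (b i * (\<psi> (\<xi> i + X i) + \<psi> (\<xi> i - X i)) + (LINT x|lborel. accel p c (\<Phi> i) (x - \<xi> i) * \<psi> x))"
        by simp
    qed simp
    also have "\<dots> = - ((\<Sum>i\<in>J K. b i * (\<psi> (\<xi> i + X i) + \<psi> (\<xi> i - X i)))
        + (\<Sum>i\<in>J K. LINT x|lborel. accel p c (\<Phi> i) (x - \<xi> i) * \<psi> x))"
      by (simp only: sum_negf sum.distrib)
    also have "(\<Sum>i\<in>J K. LINT x|lborel. accel p c (\<Phi> i) (x - \<xi> i) * \<psi> x) = (LINT x|lborel. g x * \<psi> x)"
      unfolding g_eq K_def
      by (rule family_integral(2)[symmetric, OF compact_supp[OF \<psi>] cont(1)[OF \<psi>]])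
         (simp_all add: deriv_eq_0_outside_supp accel_int \<Phi>_A)
    \<comment> \<open>Interchange of the sum over bumps with the sum over end points. A bump meeting
      \<open>K\<close> may have an end point outside \<open>K\<close>; it contributes nothing
      because \<psi> vanishes there.\<close>
    also have "(\<Sum>i\<in>J K. b i * (\<psi> (\<xi> i + X i) + \<psi> (\<xi> i - X i))) = (\<Sum>y\<in>S \<inter> K. a y * \<psi> y)"
    proof -
      have a_eq: "a y = (\<Sum>i\<in>J K. m i y)" if "y \<in> S \<inter> K" for y
        unfolding a_def J_def
      proof (rule locally_finite_infsum)
        show "y \<in> K" using that by simp
        show "m i y = 0" if "i \<in> I" "y \<notin> A i" for i
          using that X[of i] by (auto simp: m_def A_def)
      qed (use finJ[OF K] in \<open>simp add: J_def\<close>)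
      have delta: "(\<Sum>y\<in>S \<inter> K. of_bool (y = z) * \<psi> y) = \<psi> z" if "z \<in> S" for z
      proof -
        have "(\<Sum>y\<in>S \<inter> K. of_bool (y = z) * \<psi> y) = (\<Sum>y\<in>S \<inter> K. if y = z then \<psi> y else 0)"
          by (rule sum.cong) auto
        also have "\<dots> = \<psi> z"
          using that deriv_eq_0_outside_supp(1)[of z \<psi>] S_fin[OF K] by (auto simp: K_def)
        finally show ?thesis .
      qed
      have "(\<Sum>y\<in>S \<inter> K. a y * \<psi> y) = (\<Sum>y\<in>S \<inter> K. \<Sum>i\<in>J K. m i y * \<psi> y)"
        by (simp add: a_eq sum_distrib_right)
      also have "\<dots> = (\<Sum>i\<in>J K. \<Sum>y\<in>S \<inter> K. m i y * \<psi> y)"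
        by (rule sum.swap)
      also have "\<dots> = (\<Sum>i\<in>J K. b i * ((\<Sum>y\<in>S \<inter> K. of_bool (y = \<xi> i + X i) * \<psi> y)
          + (\<Sum>y\<in>S \<inter> K. of_bool (y = \<xi> i - X i) * \<psi> y)))"
        by (simp only: m_def distrib_right distrib_left sum.distrib sum_distrib_left mult.assoc)
      also have "\<dots> = (\<Sum>i\<in>J K. b i * (\<psi> (\<xi> i + X i) + \<psi> (\<xi> i - X i)))"
      proof (rule sum.cong)
        fix i assume "i \<in> J K"
        then have "\<xi> i + X i \<in> S" "\<xi> i - X i \<in> S"
          by (auto simp: J_def S_def)
        then show "b i * ((\<Sum>y\<in>S \<inter> K. of_bool (y = \<xi> i + X i) * \<psi> y)
          + (\<Sum>y\<in>S \<inter> K. of_bool (y = \<xi> i - X i) * \<psi> y)) = b i * (\<psi> (\<xi> i + X i) + \<psi> (\<xi> i - X i))"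
          by (simp only: delta)
      qed simp
      finally show ?thesis by simp
    qed
    finally show "- dist_fun (\<lambda>x. \<phi> x * w x) (deriv \<psi>) = dist_fun g \<psi> + (\<Sum>y\<in>S \<inter> supp \<psi>. a y * \<psi> y)"
      by (simp add: dist_fun_def K_def)
  qed
  have eq3: "dist_eq
      (\<lambda>\<psi>. - c * dist_deriv (dist_fun \<phi>) \<psi>
         + dist_deriv (\<lambda>\<eta>. dist_meas (\<lambda>x. \<phi> x * g x) S (\<lambda>y. \<phi> y * a y) \<eta>
                           + dist_fun (\<lambda>x. \<bar>\<phi> x\<bar> powr (p - 2) * \<phi> x) \<eta>) \<psi>)
      (\<lambda>\<psi>. 0)"
    unfolding dist_eq_def
  proof (intro allI impI)
    fix \<psi> assume \<psi>: "test_function \<psi>"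
    let ?n = "\<lambda>x. \<bar>\<phi> x\<bar> powr (p - 2) * \<phi> x * deriv \<psi> x"
    obtain M where M: "\<forall>x\<in>supp \<psi>. \<bar>\<phi> x\<bar> \<le> M"
      using \<phi>_bdd compact_supp[OF \<psi>] by blast
    have [measurable]: "deriv \<psi> \<in> borel_measurable borel"
      using cont(2)[OF \<psi>] by (rule borel_measurable_continuous_onI)
    \<comment> \<open>On the support of \<psi> the factor |\<phi>|^(p-2) is at most M^(p-2), since
      the exponent is nonnegative.\<close>
    have n_int: "integrable lborel ?n"
    proof (rule Bochner_Integration.integrable_bound)
      show "integrable lborel (\<lambda>x. M powr (p - 2) * (\<phi> x * deriv \<psi> x))"
        using \<phi>_integral(1)[OF \<psi>] by simp
      have "\<bar>?n x\<bar> \<le> \<bar>M powr (p - 2) * (\<phi> x * deriv \<psi> x)\<bar>" for x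
      proof (cases "x \<in> supp \<psi>")
        case True
        then have "\<bar>\<phi> x\<bar> powr (p - 2) \<le> M powr (p - 2)"
          using p M by (intro powr_mono2) auto
        then have "\<bar>\<phi> x\<bar> powr (p - 2) * \<bar>\<phi> x * deriv \<psi> x\<bar> \<le> M powr (p - 2) * \<bar>\<phi> x * deriv \<psi> x\<bar>"
          by (rule mult_right_mono) simp
        then show ?thesis by (simp add: abs_mult mult.assoc)
      qed (simp add: deriv_eq_0_outside_supp)
      then show "AE x in lborel. norm (?n x) \<le> norm (M powr (p - 2) * (\<phi> x * deriv \<psi> x))"
        by simp
    qed measurable
    \<comment> \<open>This also holds at zeros of \<phi>, where the value 0 of \<open>accel\<close>
      is multiplied by \<phi>. Integrated, it is exactly the cancellation that the equation
      demands.\<close>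
    have "\<phi> x * g x * deriv \<psi> x = c * (\<phi> x * deriv \<psi> x) - ?n x" for x
      by (simp add: g_def accel_def algebra_simps)
    then have "(LINT x|lborel. \<phi> x * g x * deriv \<psi> x) =
        c * (LINT x|lborel. \<phi> x * deriv \<psi> x) - (LINT x|lborel. ?n x)"
      using n_int \<phi>_integral(1)[OF \<psi>] by simp
    \<comment> \<open>Multiplication by \<phi> kills every Dirac mass, because no end point is
      interior to a bump.\<close>
    moreover have "(\<Sum>y\<in>S \<inter> supp (deriv \<psi>). \<phi> y * a y * deriv \<psi> y) = 0"
      using \<phi>_S by (intro sum.neutral) auto
    ultimately show "- c * dist_deriv (dist_fun \<phi>) \<psi>
         + dist_deriv (\<lambda>\<eta>. dist_meas (\<lambda>x. \<phi> x * g x) S (\<lambda>y. \<phi> y * a y) \<eta>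
                           + dist_fun (\<lambda>x. \<bar>\<phi> x\<bar> powr (p - 2) * \<phi> x) \<eta>) \<psi> = 0"
      by (simp add: dist_deriv_def dist_meas_def dist_fun_def)
  qed
  have "solves_profile_eq p c \<phi>"
    unfolding solves_profile_eq_def
    using \<phi>_cont w_loc eq1 g_meas g_bdd S_fin eq2 eq3 by blast
  then show ?thesis
    unfolding \<phi>_def[abs_def] .
qed

section \<open>Existence of compactons and multi-compactons\<close>

lemma compacton_exists:
  assumes p: "p \<ge> 2" and adm: "admissible p B c"
  shows "\<exists>X \<Phi> b v. weak_bump p c X b \<Phi> v \<and> is_compacton p B c X \<Phi>"
proof -
  obtain X \<Phi> b v where bump: "weak_bump p c X b \<Phi> v"
    and smooth: "smooth_on {-X<..<X} \<Phi>"
    and even: "\<And>x. \<Phi> (- x) = \<Phi> x"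
    and decr: "strict_antimono_on {0<..<X} \<Phi>"
    and first_order: "\<And>x. \<bar>x\<bar> < X \<Longrightarrow>
      - (c / 2) * (\<Phi> x)\<^sup>2 + 1 / 2 * (\<Phi> x * deriv \<Phi> x)\<^sup>2 + 1 / p * \<Phi> x powr p = B"
    using compacton_profile[OF p adm] by metis
  \<comment> \<open>A single compacton is the superposition over a one-element index set.\<close>
  have "solves_profile_eq p c (\<lambda>x. \<Sum>\<^sub>\<infinity>i\<in>{0::nat}. 1 * \<Phi> (x - 0))"
    using p bump
    by (intro solves_profile_eq_superposition[where X = "\<lambda>_. X" and b = "\<lambda>_. b" and v = "\<lambda>_. v"])
       (auto simp: locally_finite_family_def non_overlapping_def disjoint_family_on_def)
  then have eq: "solves_profile_eq p c \<Phi>" by simp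
  have inside: "x \<in> {-X<..<X} \<longleftrightarrow> \<bar>x\<bar> < X" for x by auto
  have "0 \<le> \<Phi> x" for x
    using weak_bumpD(3,4)[OF bump, of x] by (cases "\<bar>x\<bar> < X") (auto intro: less_imp_le)
  then have "is_compacton p B c X \<Phi>"
    unfolding is_compacton_def Ball_def inside not_less
    using weak_bumpD(1,3,4)[OF bump] smooth even decr eq first_order by blast
  with bump show ?thesis by blast
qed

theorem theorem1p1:
  fixes p :: real
  assumes "p \<ge> 2"
  shows "\<exists>(X :: real \<Rightarrow> real \<Rightarrow> real) (\<Phi> :: real \<Rightarrow> real \<Rightarrow> real \<Rightarrow> real).
    (\<forall>B c. admissible p B c \<longrightarrow> is_compacton p B c (X B c) (\<Phi> B c)) \<and>
    (\<forall>(c :: real) (I :: nat set) (\<epsilon> :: nat \<Rightarrow> real) (B :: nat \<Rightarrow> real) (\<xi> :: nat \<Rightarrow> real).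
       (\<forall>i\<in>I. \<epsilon> i \<in> {1, -1} \<and> admissible p (B i) c) \<and>
       locally_finite_family I (\<lambda>i x. \<Phi> (B i) c (x - \<xi> i)) \<and>
       non_overlapping I (\<lambda>i x. \<Phi> (B i) c (x - \<xi> i)) \<longrightarrow>
       solves_profile_eq p c (\<lambda>x. \<Sum>\<^sub>\<infinity>i\<in>I. \<epsilon> i * \<Phi> (B i) c (x - \<xi> i)))"
proof -
  \<comment> \<open>The profiles are chosen once for all (B, c), with \<open>weak_bump\<close> kept
    alongside: superposition needs the derivative and the jump of these same profiles, which
    \<open>is_compacton\<close> does not expose.\<close>
  have "\<exists>X \<Phi>. \<forall>B c. admissible p B c \<longrightarrow>
      (\<exists>b v. weak_bump p c (X B c) b (\<Phi> B c) v) \<and> is_compacton p B c (X B c) (\<Phi> B c)"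
    using compacton_exists[OF assms] by metis
  then obtain X \<Phi> where
    bump: "\<And>B c. admissible p B c \<Longrightarrow> \<exists>b v. weak_bump p c (X B c) b (\<Phi> B c) v"
    and comp: "\<And>B c. admissible p B c \<Longrightarrow> is_compacton p B c (X B c) (\<Phi> B c)"
    by blast
  have "solves_profile_eq p c (\<lambda>x. \<Sum>\<^sub>\<infinity>i\<in>I. \<epsilon> i * \<Phi> (B i) c (x - \<xi> i))"
    if i: "\<forall>i\<in>I. \<epsilon> i \<in> {1, -1} \<and> admissible p (B i) c"
      and fam: "locally_finite_family I (\<lambda>i x. \<Phi> (B i) c (x - \<xi> i))"
        "non_overlapping I (\<lambda>i x. \<Phi> (B i) c (x - \<xi> i))"
    for c and I :: "nat set" and \<epsilon> B \<xi> :: "nat \<Rightarrow> real"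
  proof -
    have "\<forall>i\<in>I. \<exists>b v. weak_bump p c (X (B i) c) b (\<Phi> (B i) c) v"
      using i bump by blast
    then obtain b v where "\<And>i. i \<in> I \<Longrightarrow> weak_bump p c (X (B i) c) (b i) (\<Phi> (B i) c) (v i)"
      by metis
    then show ?thesis
      using i fam assms
      by (intro solves_profile_eq_superposition[where X = "\<lambda>i. X (B i) c" and b = b and v = v]) auto
  qed
  then show ?thesis
    using comp by blast
qed

end
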